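(* Let $d\ge1$, let $\sigma^{KN}$ be a pseudodifferential operator (with Kohn-Nirenberg symbol $\sigma$) that is bounded on $L^2(\mathbb{R}^d)$, let $\Lambda=a\mathbb{Z}^d\times b\mathbb{Z}^d$ with $a,b>0$ and $ab<1$, and let $g\in L^2(\mathbb{R}^d)$ be such that $\mathcal{G}(g,\Lambda)=\{\pi(\lambda)g:\lambda\in\Lambda\}$ is a frame for $L^2(\mathbb{R}^d)$. If there are scalars $d_\mu$, $\mu\in\Lambda$, such that $$\langle\sigma^{KN}\pi(\mu)g,\pi(\lambda)g\rangle=d_\mu\,\delta_{\lambda\mu}\quad\text{for all }\lambda,\mu\in\Lambda,$$ then $\sigma^{KN}$ is identically zero.
   Context: For $z=(x,\xi)\in\mathbb{R}^{2d}$, $\pi(z)f(t)=e^{2\pi i\xi\cdot t}f(t-x)$ for functions $f$ on $\mathbb{R}^d$. The set $\mathcal{G}(g,\Lambda)$ is a (Gabor) frame for $L^2(\mathbb{R}^d)$ if there are constants $A,B>0$ with $A\|f\|^2\le\sum_{\lambda\in\Lambda}|\langle f,\pi(\lambda)g\rangle|^2\le B\|f\|^2$ for all $f\in L^2(\mathbb{R}^d)$. The Fourier transform is $\hat f(\xi)=\int f(x)e^{-2\pi i\xi\cdot x}\,dx$ and the Rihaczek distribution is $R(f,g)(x,\xi)=f(x)\overline{\hat g(\xi)}e^{-2\pi i x\cdot\xi}$. For a symbol $\sigma\in\mathcal{S}'(\mathbb{R}^{2d})$ the operator $\sigma^{KN}:\mathcal{S}(\mathbb{R}^d)\to\mathcal{S}'(\mathbb{R}^d)$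 is defined by $\langle\sigma^{KN}f,g\rangle=\langle\sigma,R(g,f)\rangle$ for $f,g\in\mathcal{S}(\mathbb{R}^d)$ (brackets extend the $L^2$ inner product, conjugate-linear in the second argument); that it is bounded on $L^2(\mathbb{R}^d)$ means that it extends to a bounded linear operator on $L^2(\mathbb{R}^d)$, denoted by the same symbol. $\delta_{\lambda\mu}$ is the Kronecker delta. *)

theory Defs
  imports "HOL-Analysis.Analysis"
begin

section \<open>The Hilbert space of square-integrable functions\<close>

text \<open>Elements of \<open>L\<^sup>2\<close> are given by representatives; equality in \<open>L\<^sup>2\<close> is equality almost everywhere.\<close>

definition square_integrable :: "('a::euclidean_space \<Rightarrow> complex) \<Rightarrow> bool" where
  "square_integrable f \<longleftrightarrow>
     f \<in> borel_measurable lebesgue \<and> integrable lebesgue (\<lambda>x. (cmod (f x))\<^sup>2)"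

definition l2_inner :: "('a::euclidean_space \<Rightarrow> complex) \<Rightarrow> ('a \<Rightarrow> complex) \<Rightarrow> complex" where
  "l2_inner f g = (LINT x|lebesgue. f x * cnj (g x))"

definition l2_norm :: "('a::euclidean_space \<Rightarrow> complex) \<Rightarrow> real" where
  "l2_norm f = sqrt (LINT x|lebesgue. (cmod (f x))\<^sup>2)"

text \<open>Linearity (almost everywhere) together with boundedness makes such an operator respect
  equality almost everywhere, so it is an operator on equivalence classes.\<close>

definition bounded_l2_operator ::
    "(('a::euclidean_space \<Rightarrow> complex) \<Rightarrow> ('a \<Rightarrow> complex)) \<Rightarrow> bool" where
  "bounded_l2_operator T \<longleftrightarrow>
     (\<forall>f. square_integrable f \<longrightarrow> square_integrable (T f)) \<and>
     (\<forall>f h \<alpha> \<beta>. square_integrable f \<longrightarrow> square_integrable h \<longrightarrow>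
        (AE x in lebesgue. T (\<lambda>y. \<alpha> * f y + \<beta> * h y) x = \<alpha> * T f x + \<beta> * T h x)) \<and>
     (\<exists>C. \<forall>f. square_integrable f \<longrightarrow> l2_norm (T f) \<le> C * l2_norm f)"

section \<open>Schwartz functions and tempered distributions\<close>

primrec iter_partial ::
    "'a list \<Rightarrow> ('a::euclidean_space \<Rightarrow> complex) \<Rightarrow> 'a \<Rightarrow> complex" where
  "iter_partial [] f = f"
| "iter_partial (v # vs) f = (\<lambda>x. frechet_derivative (iter_partial vs f) (at x) v)"

text \<open>Lists of basis vectors play the role of multi-indices.  Differentiability of all iterated
  partial derivatives amounts to smoothness.\<close>

definition schwartz :: "('a::euclidean_space \<Rightarrow> complex) \<Rightarrow> bool" where
  "schwartz f \<longleftrightarrow>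
     (\<forall>vs. set vs \<subseteq> Basis \<longrightarrow>
        iter_partial vs f differentiable_on UNIV \<and>
        (\<forall>k::nat. \<exists>C. \<forall>x. norm x ^ k * cmod (iter_partial vs f x) \<le> C))"

definition schwartz_seminorm ::
    "nat \<Rightarrow> 'a list \<Rightarrow> ('a::euclidean_space \<Rightarrow> complex) \<Rightarrow> real" where
  "schwartz_seminorm k vs f = (SUP x. norm x ^ k * cmod (iter_partial vs f x))"

text \<open>A tempered distribution is a linear functional on the Schwartz space which is continuous,
  that is, dominated by finitely many seminorms.  Its values outside the Schwartz space are
  irrelevant.\<close>

definition tempered_distribution :: "(('a::euclidean_space \<Rightarrow> complex) \<Rightarrow> complex) \<Rightarrow> bool" where
  "tempered_distribution u \<longleftrightarrow>
     (\<forall>\<phi> \<psi> \<alpha> \<beta>. schwartz \<phi> \<longrightarrow> schwartz \<psi> \<longrightarrow>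
        u (\<lambda>x. \<alpha> * \<phi> x + \<beta> * \<psi> x) = \<alpha> * u \<phi> + \<beta> * u \<psi>) \<and>
     (\<exists>C N. \<forall>\<phi>. schwartz \<phi> \<longrightarrow>
        cmod (u \<phi>) \<le>
          C * (\<Sum>k\<le>N. \<Sum>vs\<in>{vs. set vs \<subseteq> Basis \<and> length vs \<le> N}. schwartz_seminorm k vs \<phi>))"

text \<open>The sesquilinear bracket extending the inner product of \<open>L\<^sup>2\<close>: a function \<open>h\<close> is identified
  with the linear functional \<open>\<phi> \<mapsto> \<integral> h \<phi>\<close>, whence the conjugation.\<close>

definition bracket ::
    "(('a::euclidean_space \<Rightarrow> complex) \<Rightarrow> complex) \<Rightarrow> ('a \<Rightarrow> complex) \<Rightarrow> complex" where
  "bracket u \<phi> = u (\<lambda>x. cnj (\<phi> x))"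

section \<open>Kohn--Nirenberg operators\<close>

definition fourier :: "('a::euclidean_space \<Rightarrow> complex) \<Rightarrow> 'a \<Rightarrow> complex" where
  "fourier f \<xi> = (LINT x|lebesgue. f x * exp (- 2 * of_real pi * \<i> * of_real (\<xi> \<bullet> x)))"

definition rihaczek ::
    "('a::euclidean_space \<Rightarrow> complex) \<Rightarrow> ('a \<Rightarrow> complex) \<Rightarrow> 'a \<times> 'a \<Rightarrow> complex" where
  "rihaczek f g = (\<lambda>(x, \<xi>).
     f x * cnj (fourier g \<xi>) * exp (- 2 * of_real pi * \<i> * of_real (x \<bullet> \<xi>)))"

text \<open>The distribution \<open>kn_operator \<sigma> f\<close>, evaluated as a linear functional; the defining sesquilinear
  identity is the lemma below.\<close>

definition kn_operator ::
    "(('a::euclidean_space \<times> 'a \<Rightarrow> complex) \<Rightarrow> complex) \<Rightarrow> ('a \<Rightarrow> complex) \<Rightarrow>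
     ('a \<Rightarrow> complex) \<Rightarrow> complex" where
  "kn_operator \<sigma> f = (\<lambda>h. bracket \<sigma> (rihaczek (\<lambda>x. cnj (h x)) f))"

lemma bracket_kn_operator: "bracket (kn_operator \<sigma> f) g = bracket \<sigma> (rihaczek g f)"
  by (simp add: bracket_def kn_operator_def)

text \<open>\<open>T\<close> is a bounded operator on \<open>L\<^sup>2\<close> that extends the Kohn--Nirenberg operator of \<open>\<sigma>\<close>;
  the distribution \<open>kn_operator \<sigma> f\<close> is then the one represented by the function \<open>T f\<close>.\<close>

definition kn_bounded_extension ::
    "(('a::euclidean_space \<times> 'a \<Rightarrow> complex) \<Rightarrow> complex) \<Rightarrow>
     (('a \<Rightarrow> complex) \<Rightarrow> ('a \<Rightarrow> complex)) \<Rightarrow> bool" where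
  "kn_bounded_extension \<sigma> T \<longleftrightarrow>
     bounded_l2_operator T \<and>
     (\<forall>f g. schwartz f \<longrightarrow> schwartz g \<longrightarrow> l2_inner (T f) g = bracket (kn_operator \<sigma> f) g)"

section \<open>Gabor frames\<close>

definition tf_shift ::
    "'a \<times> 'a \<Rightarrow> ('a::euclidean_space \<Rightarrow> complex) \<Rightarrow> 'a \<Rightarrow> complex" where
  "tf_shift z f = (\<lambda>t. exp (2 * of_real pi * \<i> * of_real (snd z \<bullet> t)) * f (t - fst z))"

text \<open>The system is indexed by \<open>\<Lambda>\<close>.  Summability is stated explicitly since \<open>infsum\<close> is \<open>0\<close>
  for divergent sums.\<close>

definition gabor_frame ::
    "('a::euclidean_space \<Rightarrow> complex) \<Rightarrow> ('a \<times> 'a) set \<Rightarrow> bool" where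
  "gabor_frame g \<Lambda> \<longleftrightarrow>
     (\<exists>A>0. \<exists>B>0. \<forall>f. square_integrable f \<longrightarrow>
        (\<lambda>z. (cmod (l2_inner f (tf_shift z g)))\<^sup>2) summable_on \<Lambda> \<and>
        A * (l2_norm f)\<^sup>2 \<le> (\<Sum>\<^sub>\<infinity>z\<in>\<Lambda>. (cmod (l2_inner f (tf_shift z g)))\<^sup>2) \<and>
        (\<Sum>\<^sub>\<infinity>z\<in>\<Lambda>. (cmod (l2_inner f (tf_shift z g)))\<^sup>2) \<le> B * (l2_norm f)\<^sup>2)"

definition int_lattice :: "(real ^ 'n) set" where
  "int_lattice = {x. \<forall>i. x $ i \<in> \<int>}"

definition rect_lattice :: "real \<Rightarrow> real \<Rightarrow> ((real ^ 'n) \<times> (real ^ 'n)) set" where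
  "rect_lattice a b = (\<lambda>x. a *\<^sub>R x) ` int_lattice \<times> (\<lambda>x. b *\<^sub>R x) ` int_lattice"

end

theory Submission
  imports Defs
begin

text \<open>
  Write \<open>g\<^sub>\<lambda>\<close> for \<open>\<pi>(\<lambda>)g\<close>.  If the matrix of \<open>T\<close> with respect to the frame is diagonal, then
  \<open>u = T g\<^sub>\<mu>\<close> is orthogonal to every \<open>g\<^sub>\<nu>\<close> with \<open>\<nu> \<noteq> \<mu>\<close>, and \<open>\<langle>u, g\<^sub>\<mu>\<rangle> = d\<^sub>\<mu>\<close>.  Thus \<open>d\<^sub>\<mu> \<noteq> 0\<close> would make
  \<open>u\<close>, up to a factor, a member of a system biorthogonal to the frame, and time-frequency shifts of \<open>u\<close>
  would supply the other members: the frame would be a Riesz basis.  Below the critical density, that is, for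
  \<open>a b < 1\<close>, a Gabor frame is redundant and admits no such vector (\<open>frame_not_biorthogonal\<close>).  Hence all \<open>d\<^sub>\<mu>\<close>
  vanish, each \<open>T g\<^sub>\<mu>\<close> is orthogonal to the whole frame, and \<open>T g\<^sub>\<mu> = 0\<close> by the lower frame bound.  Since
  finite combinations of the frame elements are dense, \<open>T = 0\<close> (\<open>bounded_l2_operator_zero_on_frame\<close>).

  The heart of the matter is the redundancy.  A system biorthogonal to a frame yields an expansion of
  every \<open>f\<close> (\<open>biorthogonal_expansion\<close>).  For the indicator of a cube of side \<open>a\<close> this expansion is compared
  with a direct evaluation: since the cube fits into one of side \<open>1/b\<close>, the sum over the modulations is
  given by Parseval's identity (\<open>Parseval_cube\<close>), and the sum over the translations reassembles an integral over
  the whole space from the tiling by cubes of side \<open>a\<close> (\<open>tiling_integral\<close>).  The two values agree only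
  if \<open>a b = 1\<close>.

  Parseval's identity needs the completeness of the exponentials on a cube.  It is deduced from the
  Stone-Weierstrass theorem on the torus and the approximation of measurable functions by continuous
  ones.
\<close>

section \<open>Translation invariance of Lebesgue measure\<close>

lemma measurable_lebesgue_translate:
  fixes x :: "'a::euclidean_space"
  shows "(\<lambda>t. t - x) \<in> lebesgue \<rightarrow>\<^sub>M lebesgue"
proof -
  have "(\<lambda>t. - x + (\<Sum>j\<in>Basis. (1 * (t \<bullet> j)) *\<^sub>R j)) \<in> lebesgue \<rightarrow>\<^sub>M lebesgue"
    by (rule lebesgue_affine_measurable) simp
  then show ?thesis by (simp add: euclidean_representation)
qed

lemma distr_lebesgue_translate:
  fixes x :: "'a::euclidean_space"
  shows "distr lebesgue lebesgue (\<lambda>t. t - x) = lebesgue"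
proof -
  have "lebesgue = density (distr lebesgue lebesgue (\<lambda>t. t - x)) (\<lambda>_. 1)"
    using lebesgue_affine_euclidean[of "\<lambda>_::'a. 1" "- x"] by (simp add: euclidean_representation)
  then show ?thesis by (simp add: density_1)
qed

lemma borel_measurable_lebesgue_translate:
  fixes f :: "'a::euclidean_space \<Rightarrow> 'b::topological_space"
  assumes "f \<in> borel_measurable lebesgue"
  shows "(\<lambda>t. f (t - x)) \<in> borel_measurable lebesgue"
  using measurable_compose[OF measurable_lebesgue_translate assms] by simp

lemma integrable_lebesgue_translate:
  fixes f :: "'a::euclidean_space \<Rightarrow> 'b::{banach, second_countable_topology}"
  assumes "integrable lebesgue f"
  shows "integrable lebesgue (\<lambda>t. f (t - x))"
  using integrable_distr[OF measurable_lebesgue_translate, where f=f and x1=x] assms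
  by (simp add: distr_lebesgue_translate)

lemma integral_lebesgue_translate:
  fixes f :: "'a::euclidean_space \<Rightarrow> 'b::{banach, second_countable_topology}"
  assumes "f \<in> borel_measurable lebesgue"
  shows "(LINT t|lebesgue. f (t - x)) = (LINT t|lebesgue. f t)"
  using integral_distr[OF measurable_lebesgue_translate assms, of x]
  by (simp add: distr_lebesgue_translate)

section \<open>The inner product space of square-integrable functions\<close>

lemma borel_measurable_cnj:
  assumes "f \<in> borel_measurable M"
  shows "(\<lambda>x. cnj (f x)) \<in> borel_measurable M"
  using measurable_compose[OF assms borel_measurable_continuous_onI[OF continuous_on_cnj[OF continuous_on_id]]]
  by simp

lemma square_integrable_integrable_mult_cnj:
  assumes "square_integrable f" "square_integrable g"
  shows "integrable lebesgue (\<lambda>x. f x * cnj (g x))"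
proof (rule Bochner_Integration.integrable_bound)
  show "integrable lebesgue (\<lambda>x. (cmod (f x))\<^sup>2 + (cmod (g x))\<^sup>2)"
    using assms by (auto simp: square_integrable_def)
  show "(\<lambda>x. f x * cnj (g x)) \<in> borel_measurable lebesgue"
    using assms unfolding square_integrable_def by (intro borel_measurable_times borel_measurable_cnj) auto
  have "u * v \<le> u\<^sup>2 + v\<^sup>2" if "u \<ge> 0" "v \<ge> 0" for u v :: real
    using that sum_squares_bound[of u v] mult_nonneg_nonneg[of u v] by linarith
  then show "AE x in lebesgue. cmod (f x * cnj (g x)) \<le> norm ((cmod (f x))\<^sup>2 + (cmod (g x))\<^sup>2)"
    by (auto simp: norm_mult)
qed

lemma square_integrable_lincomb:
  assumes "square_integrable f" "square_integrable g"
  shows "square_integrable (\<lambda>x. \<alpha> * f x + \<beta> * g x)"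
  unfolding square_integrable_def
proof
  have f[measurable]: "f \<in> borel_measurable lebesgue" and g[measurable]: "g \<in> borel_measurable lebesgue"
    using assms by (auto simp: square_integrable_def)
  show "(\<lambda>x. \<alpha> * f x + \<beta> * g x) \<in> borel_measurable lebesgue" by measurable
  show "integrable lebesgue (\<lambda>x. (cmod (\<alpha> * f x + \<beta> * g x))\<^sup>2)"
  proof (rule Bochner_Integration.integrable_bound)
    show "integrable lebesgue
        (\<lambda>x. 2 * (cmod \<alpha>)\<^sup>2 * (cmod (f x))\<^sup>2 + 2 * (cmod \<beta>)\<^sup>2 * (cmod (g x))\<^sup>2)"
      using assms by (auto simp: square_integrable_def)
    have "(cmod (z + w))\<^sup>2 \<le> 2 * (cmod z)\<^sup>2 + 2 * (cmod w)\<^sup>2" for z w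
    proof -
      have "(cmod (z + w))\<^sup>2 \<le> (cmod z + cmod w)\<^sup>2"
        by (intro power_mono norm_triangle_ineq) auto
      also have "\<dots> \<le> 2 * (cmod z)\<^sup>2 + 2 * (cmod w)\<^sup>2"
        using sum_squares_bound[of "cmod z" "cmod w"] by (simp add: power2_sum)
      finally show ?thesis .
    qed
    from this[of "\<alpha> * f _" "\<beta> * g _"]
    show "AE x in lebesgue. norm ((cmod (\<alpha> * f x + \<beta> * g x))\<^sup>2)
        \<le> norm (2 * (cmod \<alpha>)\<^sup>2 * (cmod (f x))\<^sup>2 + 2 * (cmod \<beta>)\<^sup>2 * (cmod (g x))\<^sup>2)"
      by (auto simp: norm_mult power_mult_distrib mult.assoc intro!: AE_I2)
  qed measurable
qed

lemma square_integrable_zero: "square_integrable (\<lambda>x. 0)"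
  by (simp add: square_integrable_def)

lemma square_integrable_cmult: "square_integrable f \<Longrightarrow> square_integrable (\<lambda>x. c * f x)"
  using square_integrable_lincomb[of f f c 0] by simp

lemma square_integrable_add:
  "square_integrable f \<Longrightarrow> square_integrable g \<Longrightarrow> square_integrable (\<lambda>x. f x + g x)"
  using square_integrable_lincomb[of f g 1 1] by simp

lemma square_integrable_diff:
  "square_integrable f \<Longrightarrow> square_integrable g \<Longrightarrow> square_integrable (\<lambda>x. f x - g x)"
  using square_integrable_lincomb[of f g 1 "-1"] by simp

lemma square_integrable_sum:
  "(\<And>i. i \<in> I \<Longrightarrow> square_integrable (f i)) \<Longrightarrow> square_integrable (\<lambda>x. \<Sum>i\<in>I. f i x)"
  by (induction I rule: infinite_finite_induct)
     (auto intro: square_integrable_zero square_integrable_add)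

lemma square_integrable_bounded_mult:
  assumes "square_integrable f" and [measurable]: "h \<in> borel_measurable lebesgue"
    and "\<And>x. cmod (h x) \<le> 1"
  shows "square_integrable (\<lambda>x. h x * f x)"
  unfolding square_integrable_def
proof
  have f[measurable]: "f \<in> borel_measurable lebesgue" 
    using assms by (auto simp: square_integrable_def)
  show "(\<lambda>x. h x * f x) \<in> borel_measurable lebesgue" by measurable
  show "integrable lebesgue (\<lambda>x. (cmod (h x * f x))\<^sup>2)"
  proof (rule Bochner_Integration.integrable_bound)
    show "integrable lebesgue (\<lambda>x. (cmod (f x))\<^sup>2)"
      using assms by (auto simp: square_integrable_def)
    have "cmod (h x) * cmod (f x) \<le> cmod (f x)" for x
      using assms(3)[of x] by (simp add: mult_left_le_one_le)
    then show "AE x in lebesgue. norm ((cmod (h x * f x))\<^sup>2) \<le> norm ((cmod (f x))\<^sup>2)"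
      by (auto simp: norm_mult power_mono intro!: AE_I2)
  qed measurable
qed

lemma l2_inner_add_left:
  assumes "square_integrable f" "square_integrable h" "square_integrable g"
  shows "l2_inner (\<lambda>x. f x + h x) g = l2_inner f g + l2_inner h g"
  using assms by (simp add: l2_inner_def ring_distribs square_integrable_integrable_mult_cnj)

lemma l2_inner_diff_left:
  assumes "square_integrable f" "square_integrable h" "square_integrable g"
  shows "l2_inner (\<lambda>x. f x - h x) g = l2_inner f g - l2_inner h g"
  using assms by (simp add: l2_inner_def ring_distribs square_integrable_integrable_mult_cnj)

lemma l2_inner_cmult_left: "l2_inner (\<lambda>x. c * f x) g = c * l2_inner f g"
  by (simp add: l2_inner_def mult.assoc)

lemma l2_inner_sum_left:
  assumes "\<And>i. i \<in> I \<Longrightarrow> square_integrable (f i)" "square_integrable g"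
  shows "l2_inner (\<lambda>x. \<Sum>i\<in>I. f i x) g = (\<Sum>i\<in>I. l2_inner (f i) g)"
proof -
  have "l2_inner (\<lambda>x. \<Sum>i\<in>I. f i x) g = (LINT x|lebesgue. (\<Sum>i\<in>I. f i x * cnj (g x)))"
    by (simp add: l2_inner_def sum_distrib_right)
  also have "\<dots> = (\<Sum>i\<in>I. l2_inner (f i) g)"
    unfolding l2_inner_def
    by (intro Bochner_Integration.integral_sum square_integrable_integrable_mult_cnj assms)
  finally show ?thesis .
qed

lemma l2_inner_commute: "l2_inner g f = cnj (l2_inner f g)"
  unfolding l2_inner_def by (subst Bochner_Integration.integral_cnj[symmetric]) (simp add: mult.commute)

lemma l2_norm_square: "(l2_norm f)\<^sup>2 = (LINT x|lebesgue. (cmod (f x))\<^sup>2)"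
  by (simp add: l2_norm_def)

lemma l2_norm_nonneg [simp]: "l2_norm f \<ge> 0"
  by (simp add: l2_norm_def)

lemma l2_inner_self: "l2_inner f f = of_real ((l2_norm f)\<^sup>2)"
proof -
  have "f x * cnj (f x) = of_real ((cmod (f x))\<^sup>2)" for x
    by (simp only: complex_norm_square)
  then show ?thesis
    by (simp only: l2_norm_square l2_inner_def integral_complex_of_real)
qed

lemma l2_norm_diff_square:
  assumes f: "square_integrable f" and g: "square_integrable g"
  shows "(l2_norm (\<lambda>x. f x - g x))\<^sup>2 = (l2_norm f)\<^sup>2 - 2 * Re (l2_inner f g) + (l2_norm g)\<^sup>2"
proof -
  let ?d = "\<lambda>x. f x - g x"
  have d: "square_integrable ?d" using f g by (rule square_integrable_diff)
  have "l2_inner ?d ?d = l2_inner f ?d - l2_inner g ?d"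
    by (rule l2_inner_diff_left[OF f g d])
  also have "\<dots> = cnj (l2_inner ?d f) - cnj (l2_inner ?d g)"
    by (simp flip: l2_inner_commute)
  also have "\<dots> = l2_inner f f - l2_inner f g - (cnj (l2_inner f g) - l2_inner g g)"
    by (simp add: l2_inner_diff_left f g flip: l2_inner_commute)
  finally have "Re (l2_inner ?d ?d) = Re (l2_inner f f - l2_inner f g - (cnj (l2_inner f g) - l2_inner g g))"
    by simp
  then show ?thesis by (simp add: l2_inner_self)
qed

lemma l2_norm_cmult: "l2_norm (\<lambda>x. c * f x) = cmod c * l2_norm f"
  by (simp add: l2_norm_def norm_mult power_mult_distrib real_sqrt_mult)

text \<open>The classical quadratic argument: \<open>\<parallel>f - r \<langle>f,g\<rangle> g\<parallel>\<^sup>2 \<ge> 0\<close> is tested at \<open>r = 1 / \<parallel>g\<parallel>\<^sup>2\<close>,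
  or, when \<open>\<parallel>g\<parallel> = 0\<close>, at a large \<open>r\<close>.\<close>

lemma l2_Cauchy_Schwarz:
  assumes f: "square_integrable f" and g: "square_integrable g"
  shows "cmod (l2_inner f g) \<le> l2_norm f * l2_norm g"
proof -
  define s where "s = l2_inner f g"
  have *: "0 \<le> (l2_norm f)\<^sup>2 - 2 * r * (cmod s)\<^sup>2 + r\<^sup>2 * (cmod s)\<^sup>2 * (l2_norm g)\<^sup>2" for r :: real
  proof -
    let ?h = "\<lambda>x. (of_real r * s) * g x"
    have "Re (l2_inner f ?h) = r * (cmod s)\<^sup>2"
    proof -
      have "l2_inner f ?h = cnj (of_real r * s * cnj s)"
        by (subst l2_inner_commute, subst l2_inner_cmult_left, subst l2_inner_commute[of g f])
           (simp add: s_def)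
      also have "\<dots> = of_real (r * (cmod s)\<^sup>2)"
        by (simp only: mult.assoc complex_norm_square[symmetric]) simp
      finally show ?thesis by simp
    qed
    moreover have "(l2_norm ?h)\<^sup>2 = r\<^sup>2 * (cmod s)\<^sup>2 * (l2_norm g)\<^sup>2"
      by (simp only: l2_norm_cmult) (simp add: norm_mult power_mult_distrib)
    ultimately show ?thesis
      using l2_norm_diff_square[OF f square_integrable_cmult[OF g, of "of_real r * s"]]
        zero_le_power2[of "l2_norm (\<lambda>x. f x - ?h x)"]
      by (simp add: mult_ac)
  qed
  have "(cmod s)\<^sup>2 \<le> (l2_norm f)\<^sup>2 * (l2_norm g)\<^sup>2"
  proof (cases "l2_norm g = 0")
    case True
    have "2 * r * (cmod s)\<^sup>2 \<le> (l2_norm f)\<^sup>2" for r using *[of r] True by simp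
    from this[of "((l2_norm f)\<^sup>2 + 1) / (2 * (cmod s)\<^sup>2)"] have "s = 0"
      by (cases "s = 0") simp_all
    then show ?thesis by simp
  next
    case False
    define G where "G = (l2_norm g)\<^sup>2"
    have G: "0 < G" using False by (simp add: G_def)
    have "0 \<le> (l2_norm f)\<^sup>2 - (cmod s)\<^sup>2 / G"
    proof -
      have "(1 / G)\<^sup>2 * (cmod s)\<^sup>2 * G = (cmod s)\<^sup>2 / G" "2 * (1 / G) * (cmod s)\<^sup>2 = 2 * ((cmod s)\<^sup>2 / G)"
        using G by (simp_all add: field_simps power2_eq_square)
      then show ?thesis using *[of "1 / G"] unfolding G_def[symmetric] by linarith
    qed
    then show ?thesis using G by (simp add: G_def[symmetric] field_simps)
  qed
  then show ?thesis
    unfolding s_def power_mult_distrib[symmetric] by (rule power2_le_imp_le) simp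
qed

lemma l2_norm_triangle:
  assumes f: "square_integrable f" and g: "square_integrable g"
  shows "l2_norm (\<lambda>x. f x - g x) \<le> l2_norm f + l2_norm g"
proof (rule power2_le_imp_le)
  have "- Re (l2_inner f g) \<le> l2_norm f * l2_norm g"
    using l2_Cauchy_Schwarz[OF f g] abs_Re_le_cmod[of "l2_inner f g"] by linarith
  then show "(l2_norm (\<lambda>x. f x - g x))\<^sup>2 \<le> (l2_norm f + l2_norm g)\<^sup>2"
    by (simp add: l2_norm_diff_square[OF f g] power2_sum)
qed simp

lemma l2_norm_diff_triangle:
  assumes f: "square_integrable f" and g: "square_integrable g" and h: "square_integrable h"
  shows "l2_norm (\<lambda>x. f x - h x) \<le> l2_norm (\<lambda>x. f x - g x) + l2_norm (\<lambda>x. g x - h x)"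
proof -
  have "l2_norm (\<lambda>x. f x - h x) = l2_norm (\<lambda>x. (f x - g x) - (h x - g x))" by simp
  also have "\<dots> \<le> l2_norm (\<lambda>x. f x - g x) + l2_norm (\<lambda>x. h x - g x)"
    by (intro l2_norm_triangle square_integrable_diff f g h)
  also have "l2_norm (\<lambda>x. h x - g x) = l2_norm (\<lambda>x. g x - h x)"
    by (simp add: l2_norm_def norm_minus_commute)
  finally show ?thesis .
qed

lemma l2_norm_eq_0_iff:
  assumes "square_integrable f"
  shows "l2_norm f = 0 \<longleftrightarrow> (AE x in lebesgue. f x = 0)"
  using assms integral_nonneg_eq_0_iff_AE[of lebesgue "\<lambda>x. (cmod (f x))\<^sup>2"]
  by (simp add: l2_norm_def square_integrable_def)

lemma l2_norm_cong_AE: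
  assumes "AE x in lebesgue. f x = h x" "square_integrable f" "square_integrable h"
  shows "l2_norm f = l2_norm h"
  using assms unfolding l2_norm_def square_integrable_def
  by (intro arg_cong[where f=sqrt] integral_cong_AE) auto

lemma square_integrable_cnj:
  "square_integrable f \<Longrightarrow> square_integrable (\<lambda>t. cnj (f t))"
  by (simp add: square_integrable_def borel_measurable_cnj)

lemma square_integrable_translate:
  assumes "square_integrable f"
  shows "square_integrable (\<lambda>t. f (t - x))"
  using assms integrable_lebesgue_translate[of "\<lambda>t. (cmod (f t))\<^sup>2" x]
  by (simp add: square_integrable_def borel_measurable_lebesgue_translate)

section \<open>Characters and their integrals over a cube\<close>

definition character :: "'a::euclidean_space \<Rightarrow> 'a \<Rightarrow> complex" where
  "character \<nu> t = exp (2 * of_real pi * \<i> * of_real (\<nu> \<bullet> t))"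

lemma norm_character [simp]: "cmod (character \<nu> t) = 1"
  unfolding character_def by simp

lemma character_add_left: "character (\<nu> + \<mu>) t = character \<nu> t * character \<mu> t"
  by (simp add: character_def inner_add_left ring_distribs exp_add)

lemma character_zero [simp]: "character 0 t = 1" "character \<nu> 0 = 1"
  by (simp_all add: character_def)

lemma cnj_character: "cnj (character \<nu> t) = character (- \<nu>) t"
  by (simp add: character_def exp_cnj)

lemma continuous_on_character: "continuous_on S (character \<nu>)"
  unfolding character_def by (intro continuous_intros)

lemma borel_measurable_character [measurable]:
  "character \<nu> \<in> borel_measurable borel" "character \<nu> \<in> borel_measurable lebesgue"
  using borel_measurable_continuous_onI[OF continuous_on_character]
  by (auto intro!: measurable_completion simp: measurable_lborel1)

lemma lborel_integral_prod:
  fixes f :: "'a::euclidean_space \<Rightarrow> real \<Rightarrow> complex"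
  assumes f: "\<And>j. j \<in> Basis \<Longrightarrow> integrable lborel (f j)"
  shows "(LINT x|lborel. (\<Prod>j\<in>Basis. f j (x \<bullet> j))) = (\<Prod>j\<in>Basis. LINT s|lborel. f j s)"
proof -
  interpret product_sigma_finite "\<lambda>_::'a. lborel :: real measure" ..
  have [measurable]: "j \<in> Basis \<Longrightarrow> f j \<in> borel_measurable borel" for j
    using borel_measurable_integrable[OF f] by simp
  have "(LINT x|lborel. (\<Prod>j\<in>Basis. f j (x \<bullet> j)))
      = (LINT x|(\<Pi>\<^sub>M j\<in>(Basis::'a set). lborel). (\<Prod>j\<in>Basis. f j ((\<Sum>b\<in>Basis. x b *\<^sub>R b) \<bullet> j)))"
    by (subst lborel_eq, rule integral_distr) simp_all
  also have "\<dots> = (LINT x|(\<Pi>\<^sub>M j\<in>(Basis::'a set). lborel). (\<Prod>j\<in>Basis. f j (x j)))"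
    by (intro Bochner_Integration.integral_cong refl prod.cong) simp
  also have "\<dots> = (\<Prod>j\<in>Basis. LINT s|lborel. f j s)"
    by (intro product_integral_prod f) simp
  finally show ?thesis .
qed

lemma integral_character_Icc:
  fixes c L :: real
  assumes "L > 0" "c * L \<in> \<int>"
  shows "integrable lborel (\<lambda>s. indicator {0..L} s *\<^sub>R exp (2 * of_real pi * \<i> * of_real (c * s)))"
    and "(LINT s|lborel. indicator {0..L} s *\<^sub>R exp (2 * of_real pi * \<i> * of_real (c * s)))
      = (if c = 0 then of_real L else 0)"
proof -
  let ?e = "\<lambda>s. exp (2 * of_real pi * \<i> * of_real (c * s))"
  show "integrable lborel (\<lambda>s. indicator {0..L} s *\<^sub>R ?e s)"
    by (intro borel_integrable_compact) (auto intro!: continuous_intros)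
  show "(LINT s|lborel. indicator {0..L} s *\<^sub>R ?e s) = (if c = 0 then of_real L else 0)"
  proof (cases "c = 0")
    case True
    then show ?thesis using assms by (simp add: scaleR_conv_of_real)
  next
    case False
    let ?F = "\<lambda>s. ?e s / (2 * of_real pi * \<i> * of_real c)"
    have "(LINT s|lborel. indicator {0..L} s *\<^sub>R ?e s) = ?F L - ?F 0"
    proof (rule integral_FTC_Icc)
      show "(?F has_vector_derivative ?e s) (at s within {0..L})" for s
        using False
        by (auto intro!: derivative_eq_intros has_vector_derivative_real_field simp: field_simps)
    qed (use assms in \<open>auto intro!: continuous_intros\<close>)
    moreover obtain k where "c * L = of_int k" using assms(2) by (auto elim: Ints_cases)
    then have "?e L = 1"
      using exp_integer_2pi[of "of_int k"] by (simp add: mult_ac)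
    ultimately show ?thesis using False by simp
  qed
qed

text \<open>The integral over the cube factors into one-dimensional integrals of \<open>exp (2 \<pi> \<i> \<nu>\<^sub>j s)\<close> over an
  integral number of periods.\<close>

lemma integral_character_cube:
  fixes \<nu> :: "real ^ 'n"
  assumes L: "L > 0" and \<nu>: "\<And>i. \<nu> $ i * L \<in> \<int>"
  shows "(LINT t|lebesgue. indicator (cbox 0 (vec L)) t * character \<nu> t)
      = (if \<nu> = 0 then of_real (L ^ CARD('n)) else 0)"
proof -
  let ?Q = "cbox 0 (vec L) :: (real ^ 'n) set"
  let ?f = "\<lambda>j s. indicator {0..L} s *\<^sub>R exp (2 * of_real pi * \<i> * of_real ((\<nu> \<bullet> j) * s))"
  have \<nu>': "\<nu> \<bullet> j * L \<in> \<int>" if "j \<in> Basis" for j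
    using that \<nu> by (auto simp: Basis_vec_def inner_axis)
  have "(LINT t|lebesgue. indicator ?Q t * character \<nu> t)
      = (LINT t|lborel. indicator ?Q t * character \<nu> t)"
    by (rule integral_completion) simp
  also have "\<dots> = (LINT t|lborel. (\<Prod>j\<in>Basis. ?f j (t \<bullet> j)))"
  proof (intro Bochner_Integration.integral_cong refl)
    fix t :: "real ^ 'n"
    have 1: "(\<Prod>j\<in>Basis. indicator {0..L} (t \<bullet> j) :: complex) = indicator ?Q t"
    proof (cases "t \<in> ?Q")
      case True
      then have "t \<bullet> j \<in> {0..L}" if "j \<in> Basis" for j
        using that by (auto simp: mem_box_cart Basis_vec_def inner_axis)
      then show ?thesis using True by simp
    next
      case False
      then obtain i where "t $ i \<notin> {0..L}" by (auto simp: mem_box_cart)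
      then have "t \<bullet> axis i 1 \<notin> {0..L}" by (simp add: inner_axis)
      moreover have "axis i 1 \<in> (Basis :: (real ^ 'n) set)" by simp
      ultimately have "(\<Prod>j\<in>Basis. indicator {0..L} (t \<bullet> j) :: complex) = 0"
        by (intro prod_zero) (auto intro!: bexI[of _ "axis i 1"])
      then show ?thesis using False by simp
    qed
    have "character \<nu> t = (\<Prod>j\<in>Basis. exp (2 * of_real pi * \<i> * of_real ((\<nu> \<bullet> j) * (t \<bullet> j))))"
      unfolding character_def euclidean_inner[of \<nu> t]
      by (simp add: exp_sum[symmetric] sum_distrib_left)
    then show "indicator ?Q t * character \<nu> t = (\<Prod>j\<in>Basis. ?f j (t \<bullet> j))"
      by (simp only: 1[symmetric] prod.distrib[symmetric] scaleR_conv_of_real of_real_indicator)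
  qed
  also have "\<dots> = (\<Prod>j\<in>Basis. LINT s|lborel. ?f j s)"
    by (intro lborel_integral_prod integral_character_Icc L \<nu>')
  also have "\<dots> = (\<Prod>j\<in>Basis. if \<nu> \<bullet> j = 0 then of_real L else 0)"
    by (intro prod.cong refl integral_character_Icc L \<nu>')
  also have "\<dots> = (if \<nu> = 0 then of_real (L ^ CARD('n)) else 0)"
  proof (cases "\<nu> = 0")
    case False
    then obtain j where "j \<in> Basis" "\<nu> \<bullet> j \<noteq> 0" by (metis euclidean_all_zero_iff)
    then show ?thesis using False by (auto intro!: prod_zero)
  qed simp
  finally show ?thesis .
qed

section \<open>Uniform approximation by trigonometric polynomials\<close>

text \<open>Trigonometric polynomials with frequencies in \<open>\<Gamma>\<close>.  The inductive form makes closure under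
  products and the passage to finite sets of frequencies immediate inductions, without normalising
  double sums.\<close>

inductive trigonometric :: "'a::euclidean_space set \<Rightarrow> ('a \<Rightarrow> complex) \<Rightarrow> bool" for \<Gamma> where
  character: "\<nu> \<in> \<Gamma> \<Longrightarrow> trigonometric \<Gamma> (character \<nu>)"
| add: "trigonometric \<Gamma> p \<Longrightarrow> trigonometric \<Gamma> q \<Longrightarrow> trigonometric \<Gamma> (\<lambda>t. p t + q t)"
| cmult: "trigonometric \<Gamma> p \<Longrightarrow> trigonometric \<Gamma> (\<lambda>t. c * p t)"

lemma trigonometric_mult:
  assumes \<Gamma>: "\<And>\<nu> \<mu>. \<nu> \<in> \<Gamma> \<Longrightarrow> \<mu> \<in> \<Gamma> \<Longrightarrow> \<nu> + \<mu> \<in> \<Gamma>"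
    and p: "trigonometric \<Gamma> p" and q: "trigonometric \<Gamma> q"
  shows "trigonometric \<Gamma> (\<lambda>t. p t * q t)"
  using p
proof induction
  case (character \<nu>)
  show ?case using q
  proof induction
    case (character \<mu>)
    then show ?case
      using trigonometric.character[OF \<Gamma>[OF \<open>\<nu> \<in> \<Gamma>\<close> \<open>\<mu> \<in> \<Gamma>\<close>]]
      by (simp add: character_add_left[abs_def])
  next
    case (add p q)
    then show ?case using trigonometric.add[OF add.IH] by (simp add: ring_distribs)
  next
    case (cmult p c)
    then show ?case using trigonometric.cmult[OF cmult.IH] by (simp add: mult_ac)
  qed
next
  case (add p q)
  then show ?case using trigonometric.add[OF add.IH] by (simp add: ring_distribs)
next
  case (cmult p c)
  then show ?case using trigonometric.cmult[OF cmult.IH] by (simp add: mult.assoc)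
qed

lemma trigonometric_const: "0 \<in> \<Gamma> \<Longrightarrow> trigonometric \<Gamma> (\<lambda>t. c)"
  using trigonometric.cmult[OF trigonometric.character, of 0 \<Gamma> c] by simp

lemma trigonometric_sum:
  assumes "0 \<in> \<Gamma>" "\<And>i. i \<in> I \<Longrightarrow> trigonometric \<Gamma> (p i)"
  shows "trigonometric \<Gamma> (\<lambda>t. \<Sum>i\<in>I. p i t)"
  using assms(2)
  by (induction I rule: infinite_finite_induct)
     (auto intro: trigonometric_const[OF assms(1)] trigonometric.add)

lemma trigonometric_continuous: "trigonometric \<Gamma> p \<Longrightarrow> continuous_on S p"
  by (induction rule: trigonometric.induct)
     (auto intro!: continuous_intros continuous_on_character)

lemma int_lattice_add: "x \<in> int_lattice \<Longrightarrow> y \<in> int_lattice \<Longrightarrow> x + y \<in> int_lattice"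
  and int_lattice_minus: "x \<in> int_lattice \<Longrightarrow> - x \<in> int_lattice"
  and int_lattice_zero: "0 \<in> int_lattice"
  by (auto simp: int_lattice_def)

lemma scaled_int_lattice_add:
  "x \<in> (\<lambda>x. c *\<^sub>R x) ` int_lattice \<Longrightarrow> y \<in> (\<lambda>x. c *\<^sub>R x) ` int_lattice \<Longrightarrow>
     x + y \<in> (\<lambda>x. c *\<^sub>R x) ` int_lattice"
  by (auto simp flip: scaleR_add_right intro: int_lattice_add)

lemma scaled_int_lattice_minus:
  "x \<in> (\<lambda>x. c *\<^sub>R x) ` int_lattice \<Longrightarrow> - x \<in> (\<lambda>x. c *\<^sub>R x) ` int_lattice"
  by (auto simp flip: scaleR_minus_right intro: int_lattice_minus)

lemma scaled_int_lattice_zero: "0 \<in> (\<lambda>x. c *\<^sub>R x) ` int_lattice"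
  using int_lattice_zero by (force intro: image_eqI[of _ _ 0])

text \<open>The quotient map onto the torus.  A continuous function on the cube whose values agree on opposite
  faces is a continuous function of \<open>to_torus b t\<close>, and there the Weierstrass theorem applies.\<close>

definition to_torus :: "real \<Rightarrow> real ^ 'n \<Rightarrow> complex ^ 'n" where
  "to_torus b t = (\<chi> i. character (b *\<^sub>R axis i 1) t)"

lemma continuous_on_to_torus: "continuous_on S (to_torus b)"
  unfolding to_torus_def by (intro continuous_intros continuous_on_character)

lemma to_torus_eqD:
  assumes "to_torus b s = to_torus b t"
  shows "b * (s $ i) - b * (t $ i) \<in> \<int>"
proof -
  have "character (b *\<^sub>R axis i 1) s = character (b *\<^sub>R axis i 1) t"
    using assms by (simp add: to_torus_def vec_eq_iff)
  then have "exp (2 * of_real pi * \<i> * of_real (b * (s $ i))) = exp (2 * of_real pi * \<i> * of_real (b * (t $ i)))"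
    by (simp add: character_def inner_axis')
  then obtain n :: int where "2 * of_real pi * \<i> * of_real (b * (s $ i))
      = 2 * of_real pi * \<i> * of_real (b * (t $ i)) + (of_int (2 * n) * pi) * \<i>"
    unfolding exp_eq by auto
  then have "2 * pi * (b * (s $ i)) = 2 * pi * (b * (t $ i)) + 2 * n * pi"
    by (auto simp: complex_eq_iff)
  then have "2 * pi * (b * (s $ i) - b * (t $ i)) = 2 * pi * of_int n" by (simp add: algebra_simps)
  then have "b * (s $ i) - b * (t $ i) = of_int n" by simp
  then show ?thesis by simp
qed

text \<open>A real polynomial in the coordinates \<open>z\<^sub>i\<close> of the torus is a polynomial in \<open>z\<^sub>i\<close> and \<open>cnj z\<^sub>i\<close>, because
  the real and imaginary parts are \<open>(z\<^sub>i + cnj z\<^sub>i) / 2\<close> and \<open>- \<i> (z\<^sub>i - cnj z\<^sub>i) / 2\<close>; both coordinates pull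
  back to characters.\<close>

lemma trigonometric_polynomial_to_torus:
  fixes q :: "complex ^ 'n \<Rightarrow> real"
  assumes "real_polynomial_function q"
  shows "trigonometric ((\<lambda>x. b *\<^sub>R x) ` int_lattice) (\<lambda>t. of_real (q (to_torus b t)))"
  using assms
proof induction
  let ?\<Gamma> = "(\<lambda>x. b *\<^sub>R x) ` (int_lattice :: (real ^ 'n) set)"
  case (linear f)
  have ax: "b *\<^sub>R axis i 1 \<in> ?\<Gamma>" for i
    by (rule imageI) (auto simp: int_lattice_def axis_def)
  have z: "trigonometric ?\<Gamma> (\<lambda>t. to_torus b t $ i)" for i
    using trigonometric.character[OF ax[of i]] by (simp add: to_torus_def)
  have cz: "trigonometric ?\<Gamma> (\<lambda>t. cnj (to_torus b t $ i))" for i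
    using trigonometric.character[OF scaled_int_lattice_minus[OF ax[of i]]]
    by (simp add: to_torus_def cnj_character)
  have comp: "trigonometric ?\<Gamma> (\<lambda>t. of_real (to_torus b t \<bullet> B))" if "B \<in> Basis" for B
  proof -
    obtain i u where B: "B = axis i u" and u: "u \<in> Basis" using \<open>B \<in> Basis\<close> by (auto simp: Basis_vec_def)
    consider "u = 1" | "u = \<i>" using u by (auto simp: Basis_complex_def)
    then show ?thesis
    proof cases
      case 1
      have *: "(\<lambda>t. of_real (to_torus b t \<bullet> B)) = (\<lambda>t. (1/2) * (to_torus b t $ i + cnj (to_torus b t $ i)))"
        by (rule ext) (simp add: B 1 inner_axis complex_eq_iff inner_complex_def)
      show ?thesis
        unfolding * by (rule trigonometric.cmult[OF trigonometric.add[OF z cz]])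
    next
      case 2
      have *: "(\<lambda>t. of_real (to_torus b t \<bullet> B))
          = (\<lambda>t. (-\<i>/2) * (to_torus b t $ i + (-1) * cnj (to_torus b t $ i)))"
        by (rule ext) (simp add: B 2 inner_axis complex_eq_iff inner_complex_def)
      show ?thesis
        unfolding * by (rule trigonometric.cmult[OF trigonometric.add[OF z trigonometric.cmult[OF cz]]])
    qed
  qed
  interpret f: bounded_linear f using linear .
  have f_sum: "f z = (\<Sum>B\<in>Basis. (z \<bullet> B) * f B)" for z
  proof -
    have "f z = f (\<Sum>B\<in>Basis. (z \<bullet> B) *\<^sub>R B)" by (simp only: euclidean_representation)
    also have "\<dots> = (\<Sum>B\<in>Basis. (z \<bullet> B) * f B)" by (simp only: f.sum f.scaleR real_scaleR_def)
    finally show ?thesis .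
  qed
  have *: "(\<lambda>t. of_real (f (to_torus b t)))
      = (\<lambda>t. \<Sum>B\<in>Basis. of_real (f B) * of_real (to_torus b t \<bullet> B) :: complex)"
    by (rule ext, subst f_sum) (simp add: mult.commute)
  show ?case
    unfolding *
    by (rule trigonometric_sum[OF scaled_int_lattice_zero trigonometric.cmult[OF comp]])
next
  case (const c)
  then show ?case by (intro trigonometric_const scaled_int_lattice_zero)
next
  case (add f g)
  then show ?case using trigonometric.add[OF add.IH] by simp
next
  case (mult f g)
  then show ?case using trigonometric_mult[OF scaled_int_lattice_add mult.IH] by simp
qed

text \<open>Vanishing on the boundary of the cube makes \<open>f\<close> constant on the fibres of the quotient map:
  distinct points of the closed cube with the same image both lie on the boundary.  Since the cube is
  compact, the induced function on the torus is continuous, and the Stone-Weierstrass theorem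
  approximates it by a polynomial.\<close>

lemma trigonometric_uniform_approximation:
  fixes f :: "real ^ 'n \<Rightarrow> complex"
  assumes b: "b > 0" and f: "continuous_on (cbox 0 (vec (1/b))) f"
    and f0: "\<And>t. t \<in> cbox 0 (vec (1/b)) \<Longrightarrow> t \<notin> box 0 (vec (1/b)) \<Longrightarrow> f t = 0"
    and e: "e > 0"
  obtains p where "trigonometric ((\<lambda>x. b *\<^sub>R x) ` int_lattice) p"
    "\<And>t. t \<in> cbox 0 (vec (1/b)) \<Longrightarrow> cmod (f t - p t) < e"
proof -
  let ?Q = "cbox 0 (vec (1/b)) :: (real ^ 'n) set"
  let ?E = "to_torus b :: real ^ 'n \<Rightarrow> complex ^ 'n"
  have fiber: "f s = f t" if st: "s \<in> ?Q" "t \<in> ?Q" "?E s = ?E t" for s t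
  proof (cases "s = t")
    case False
    then obtain i where i: "s $ i \<noteq> t $ i" by (auto simp: vec_eq_iff)
    have "0 \<le> s $ i" "s $ i \<le> 1/b" "0 \<le> t $ i" "t $ i \<le> 1/b"
      using st by (auto simp: mem_box_cart)
    then have r: "0 \<le> b * (s $ i)" "b * (s $ i) \<le> 1" "0 \<le> b * (t $ i)" "b * (t $ i) \<le> 1"
      using b by (simp_all add: pos_le_divide_eq mult.commute)
    obtain n where n: "b * (s $ i) - b * (t $ i) = of_int n"
      using to_torus_eqD[OF st(3), of i] by (auto elim: Ints_cases)
    \<comment> \<open>The coordinates differ by at most one period, so a nonzero integral difference is \<open>\<plusminus> 1\<close>.\<close>
    have "n \<noteq> 0" using n i b by (auto simp flip: right_diff_distrib)
    moreover have "of_int n \<le> (1::real)" "- 1 \<le> (of_int n :: real)" using n r by linarith+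
    then have "n \<le> 1" "- 1 \<le> n" by linarith+
    ultimately have "n = 1 \<or> n = - 1" by linarith
    then have "b * (s $ i) - b * (t $ i) = 1 \<or> b * (s $ i) - b * (t $ i) = -1"
      unfolding n by (elim disjE) simp_all
    then have "b * (s $ i) = 1 \<and> b * (t $ i) = 0 \<or> b * (s $ i) = 0 \<and> b * (t $ i) = 1"
    proof
      assume "b * (s $ i) - b * (t $ i) = 1"
      with r have "b * (s $ i) = 1 \<and> b * (t $ i) = 0" by (intro conjI) linarith+
      then show ?thesis ..
    next
      assume "b * (s $ i) - b * (t $ i) = -1"
      with r have "b * (s $ i) = 0 \<and> b * (t $ i) = 1" by (intro conjI) linarith+
      then show ?thesis ..
    qed
    moreover have "x = 1/b \<longleftrightarrow> b * x = 1" "x = 0 \<longleftrightarrow> b * x = 0" for x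
      using b by (simp_all add: eq_divide_eq mult.commute)
    ultimately have "s $ i = 1/b \<and> t $ i = 0 \<or> s $ i = 0 \<and> t $ i = 1/b"
      by blast
    then have "\<not> (0 < s $ i \<and> s $ i < 1/b)" "\<not> (0 < t $ i \<and> t $ i < 1/b)" by auto
    then have "s \<notin> box 0 (vec (1/b))" "t \<notin> box 0 (vec (1/b))"
      unfolding mem_box_cart by fastforce+
    then show ?thesis using f0 st by simp
  qed simp
  define S where "S = ?E ` ?Q"
  \<comment> \<open>Any preimage may be chosen, as \<open>f\<close> is constant on fibres.\<close>
  define \<phi> where "\<phi> z = f (SOME t. t \<in> ?Q \<and> ?E t = z)" for z
  have \<phi>: "\<phi> (?E t) = f t" if "t \<in> ?Q" for t
    unfolding \<phi>_def
  proof (rule someI2[of _ t])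
    show "f s = f t" if "s \<in> ?Q \<and> ?E s = ?E t" for s
      using fiber[OF _ \<open>t \<in> ?Q\<close>] that by blast
  qed (use that in blast)
  have S: "compact S"
    unfolding S_def by (rule compact_continuous_image[OF continuous_on_to_torus compact_cbox])
  have "continuous_on S \<phi>"
    unfolding continuous_on_closed_vimage[OF compact_imp_closed[OF S]]
  proof (intro allI impI)
    fix B :: "complex set" assume "closed B"
    have "closed (f -` B \<inter> ?Q)"
      by (rule continuous_on_closed_vimage[OF closed_cbox, THEN iffD1, rule_format, OF f \<open>closed B\<close>])
    then have "compact (?Q \<inter> (f -` B \<inter> ?Q))" by (intro compact_Int_closed compact_cbox)
    then have "closed (?E ` (?Q \<inter> (f -` B \<inter> ?Q)))"
      by (rule compact_imp_closed[OF compact_continuous_image[OF continuous_on_to_torus]])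
    moreover have "?E ` (?Q \<inter> (f -` B \<inter> ?Q)) = \<phi> -` B \<inter> S"
      using \<phi> by (auto simp: S_def)
    ultimately show "closed (\<phi> -` B \<inter> S)" by simp
  qed
  from Stone_Weierstrass_polynomial_function[OF S this e] obtain g where g: "polynomial_function g" "\<And>z. z \<in> S \<Longrightarrow> cmod (\<phi> z - g z) < e"
    by blast
  have "real_polynomial_function (Re \<circ> g)" "real_polynomial_function (Im \<circ> g)"
    using g(1)[unfolded polynomial_function_def, rule_format] bounded_linear_Re bounded_linear_Im
    by blast+
  note parts = this[THEN trigonometric_polynomial_to_torus[of _ b]]
  have g_split: "(\<lambda>t. g (?E t)) = (\<lambda>t. of_real ((Re \<circ> g) (?E t)) + \<i> * of_real ((Im \<circ> g) (?E t)))"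
    by (rule ext) (simp add: complex_eq_iff)
  show ?thesis
  proof (rule that[of "\<lambda>t. g (?E t)"])
    show "trigonometric ((\<lambda>x. b *\<^sub>R x) ` int_lattice) (\<lambda>t. g (?E t))"
      unfolding g_split by (rule trigonometric.add[OF parts(1) trigonometric.cmult[OF parts(2)]])
    show "cmod (f t - g (?E t)) < e" if "t \<in> ?Q" for t
    proof -
      have "?E t \<in> S" unfolding S_def using that by (rule imageI)
      from g(2)[OF this] show ?thesis unfolding \<phi>[OF that] .
    qed
  qed
qed

section \<open>Density of the trigonometric polynomials in the mean\<close>

lemma square_integrable_bounded_indicator:
  fixes f :: "'a::euclidean_space \<Rightarrow> complex"
  assumes f: "f \<in> borel_measurable lebesgue" and Q: "Q \<in> lmeasurable"
    and bound: "\<And>t. t \<in> Q \<Longrightarrow> cmod (f t) \<le> C"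
  shows "square_integrable (\<lambda>t. indicator Q t * f t)"
    and "C \<ge> 0 \<Longrightarrow> l2_norm (\<lambda>t. indicator Q t * f t) \<le> C * sqrt (measure lebesgue Q)"
proof -
  have Qs [measurable]: "Q \<in> sets lebesgue" and f [measurable]: "f \<in> borel_measurable lebesgue"
    using Q f by auto
  have iQ: "integrable lebesgue (\<lambda>t. C\<^sup>2 * indicator Q t :: real)"
    using Q by (intro integrable_mult_right integrable_real_indicator)
      (auto simp: fmeasurable_def)
  have le: "(cmod (indicator Q t * f t))\<^sup>2 \<le> C\<^sup>2 * indicator Q t" for t
    using bound[of t] by (auto simp: indicator_def power_mono)
  have i: "integrable lebesgue (\<lambda>t. (cmod (indicator Q t * f t))\<^sup>2)"
    by (rule Bochner_Integration.integrable_bound[OF iQ]) (use le in \<open>auto intro!: AE_I2 order_trans[OF _ abs_ge_self]\<close>)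
  then show si: "square_integrable (\<lambda>t. indicator Q t * f t)"
    by (simp add: square_integrable_def)
  assume "C \<ge> 0"
  have "(LINT t|lebesgue. (cmod (indicator Q t * f t))\<^sup>2) \<le> (LINT t|lebesgue. C\<^sup>2 * indicator Q t)"
    by (intro integral_mono i iQ le)
  also have "\<dots> = C\<^sup>2 * measure lebesgue Q"
    using Q by simp
  finally have "l2_norm (\<lambda>t. indicator Q t * f t) \<le> sqrt (C\<^sup>2 * measure lebesgue Q)"
    unfolding l2_norm_def by (rule real_sqrt_le_mono)
  then show "l2_norm (\<lambda>t. indicator Q t * f t) \<le> C * sqrt (measure lebesgue Q)"
    using \<open>C \<ge> 0\<close> by (simp add: real_sqrt_mult)
qed

lemma continuous_borel_measurable_lebesgue:
  "continuous_on UNIV f \<Longrightarrow> f \<in> borel_measurable lebesgue"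
  using borel_measurable_continuous_onI[of f]
  by (auto intro!: measurable_completion simp: measurable_lborel1)

text \<open>Membership in the \<open>L\<^sup>2\<close>-closure of the trigonometric polynomials on the cube of side \<open>1/b\<close>.\<close>

definition trig_approximable :: "real \<Rightarrow> (real ^ 'n \<Rightarrow> complex) \<Rightarrow> bool" where
  "trig_approximable b F \<longleftrightarrow> (\<forall>e>0. \<exists>p. trigonometric ((\<lambda>x. b *\<^sub>R x) ` int_lattice) p \<and>
     l2_norm (\<lambda>t. F t - indicator (cbox 0 (vec (1/b))) t * p t) < e)"

lemma trigonometric_square_integrable:
  assumes "trigonometric \<Gamma> p"
  shows "square_integrable (\<lambda>t. indicator (cbox c d) t * p t)"
proof -
  have "compact (p ` cbox c d)"
    using trigonometric_continuous[OF assms] by (intro compact_continuous_image compact_cbox)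
  then obtain C where "\<And>t. t \<in> cbox c d \<Longrightarrow> cmod (p t) \<le> C"
    using compact_imp_bounded by (force simp: bounded_iff)
  then show ?thesis
    by (intro square_integrable_bounded_indicator(1)
        continuous_borel_measurable_lebesgue trigonometric_continuous[OF assms]) auto
qed

lemma trig_approximable_closed:
  assumes F: "square_integrable F"
    and G: "\<And>e. e > 0 \<Longrightarrow> \<exists>G. square_integrable G \<and> trig_approximable b G \<and> l2_norm (\<lambda>t. F t - G t) < e"
  shows "trig_approximable b F"
  unfolding trig_approximable_def
proof (intro allI impI)
  fix e :: real assume "e > 0"
  let ?Q = "cbox 0 (vec (1/b)) :: (real ^ 'a) set"
  obtain G where G: "square_integrable G" "trig_approximable b G" "l2_norm (\<lambda>t. F t - G t) < e/2"
    using G[of "e/2"] \<open>e > 0\<close> by auto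
  then obtain p where p: "trigonometric ((\<lambda>x. b *\<^sub>R x) ` int_lattice) p"
    "l2_norm (\<lambda>t. G t - indicator ?Q t * p t) < e/2"
    using \<open>e > 0\<close> unfolding trig_approximable_def by (meson half_gt_zero)
  have "l2_norm (\<lambda>t. F t - indicator ?Q t * p t) < e"
    using l2_norm_diff_triangle[OF F G(1) trigonometric_square_integrable[OF p(1), of 0 "vec (1/b)"]] G(3) p(2)
    by linarith
  with p(1) show "\<exists>p. trigonometric ((\<lambda>x. b *\<^sub>R x) ` int_lattice) p \<and>
      l2_norm (\<lambda>t. F t - indicator ?Q t * p t) < e" by blast
qed

lemma trig_approximable_limit:
  assumes F: "square_integrable F" and G: "\<And>n::nat. square_integrable (G n)"
    and "\<And>n. trig_approximable b (G n)" and lim: "(\<lambda>n. l2_norm (\<lambda>t. F t - G n t)) \<longlonglongrightarrow> 0"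
  shows "trig_approximable b F"
proof (rule trig_approximable_closed[OF F])
  fix e :: real assume "e > 0"
  from order_tendstoD(2)[OF lim this] obtain n where "l2_norm (\<lambda>t. F t - G n t) < e"
    by (auto simp: eventually_sequentially)
  with assms(2,3) show "\<exists>G. square_integrable G \<and> trig_approximable b G \<and> l2_norm (\<lambda>t. F t - G t) < e"
    by blast
qed

lemma trig_approximable_continuous:
  fixes f :: "real ^ 'n \<Rightarrow> complex"
  assumes b: "b > 0" and f: "continuous_on UNIV f"
    and f0: "\<And>t. t \<notin> box 0 (vec (1/b)) \<Longrightarrow> f t = 0"
  shows "trig_approximable b f"
  unfolding trig_approximable_def
proof (intro allI impI)
  fix e :: real assume e: "e > 0"
  let ?Q = "cbox 0 (vec (1/b)) :: (real ^ 'n) set"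
  let ?s = "sqrt (measure lebesgue ?Q)"
  \<comment> \<open>The summand \<open>1\<close> turns the final estimate into a strict one.\<close>
  define e' where "e' = e / (?s + 1)"
  have s: "?s \<ge> 0" by simp
  then have e': "e' > 0" using e by (simp add: e'_def add_nonneg_pos)
  obtain p where p: "trigonometric ((\<lambda>x. b *\<^sub>R x) ` int_lattice) p"
    and fp: "\<And>t. t \<in> ?Q \<Longrightarrow> cmod (f t - p t) < e'"
    using trigonometric_uniform_approximation[OF b continuous_on_subset[OF f subset_UNIV] f0 e'] by blast
  have "f t - indicator ?Q t * p t = indicator ?Q t * (f t - p t)" for t
    using f0[of t] box_subset_cbox[of 0 "vec (1/b) :: real ^ 'n"] by (auto simp: indicator_def)
  then have "l2_norm (\<lambda>t. f t - indicator ?Q t * p t) = l2_norm (\<lambda>t. indicator ?Q t * (f t - p t))"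
    by simp
  also have "\<dots> \<le> e' * ?s"
    by (intro square_integrable_bounded_indicator(2) continuous_borel_measurable_lebesgue
        continuous_intros f trigonometric_continuous[OF p]) (use fp e' in \<open>auto intro: less_imp_le\<close>)
  also have "e' * ?s < e' * (?s + 1)" using e' by simp
  also have "e' * (?s + 1) = e" using s by (simp add: e'_def add_nonneg_eq_0_iff)
  finally show "\<exists>p. trigonometric ((\<lambda>x. b *\<^sub>R x) ` int_lattice) p \<and>
      l2_norm (\<lambda>t. f t - indicator ?Q t * p t) < e" using p by blast
qed

lemma l2_norm_tendsto_0:
  fixes G :: "nat \<Rightarrow> 'a::euclidean_space \<Rightarrow> complex"
  assumes w: "integrable lebesgue w"
    and m: "\<And>n. G n \<in> borel_measurable lebesgue"
    and lim: "AE t in lebesgue. (\<lambda>n. G n t) \<longlonglongrightarrow> 0"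
    and bound: "\<And>n t. (cmod (G n t))\<^sup>2 \<le> w t"
  shows "(\<lambda>n. l2_norm (G n)) \<longlonglongrightarrow> 0"
proof -
  have "(\<lambda>n. LINT t|lebesgue. (cmod (G n t))\<^sup>2) \<longlonglongrightarrow> (LINT t|(lebesgue :: 'a measure). (0::real))"
  proof (rule integral_dominated_convergence[where w = w])
    show "AE t in lebesgue. (\<lambda>n. (cmod (G n t))\<^sup>2) \<longlonglongrightarrow> 0"
      using lim
    proof eventually_elim
      case (elim t)
      from tendsto_power[OF tendsto_norm[OF elim], of 2] show ?case by simp
    qed
  qed (use m bound w in auto)
  then show ?thesis
    unfolding l2_norm_def using tendsto_real_sqrt by fastforce
qed

text \<open>Almost everywhere, a measurable \<open>F\<close> is a limit of continuous functions \<open>g n\<close>.  They are made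
  uniformly bounded by projecting their values to the disc of radius \<open>C\<close>, and made to vanish outside
  the open cube by cut-off functions \<open>cut n\<close>.  Both corrections are continuous and do not disturb the
  limit, so dominated convergence applies.\<close>

lemma trig_approximable_bounded:
  fixes F :: "real ^ 'n \<Rightarrow> complex"
  assumes b: "b > 0" and F: "F \<in> borel_measurable lebesgue"
    and F0: "\<And>t. t \<notin> cbox 0 (vec (1/b)) \<Longrightarrow> F t = 0"
    and bound: "\<And>t. cmod (F t) \<le> C"
  shows "trig_approximable b F"
proof -
  let ?Q = "cbox 0 (vec (1/b)) :: (real ^ 'n) set"
  let ?U = "box 0 (vec (1/b)) :: (real ^ 'n) set"
  have C: "C \<ge> 0" using bound[of 0] norm_ge_zero order_trans by blast
  have UQ: "?U \<subseteq> ?Q" by (rule box_subset_cbox)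
  obtain N g where N: "negligible N" and g: "\<And>n. continuous_on UNIV (g n)"
    and lim: "\<And>t. t \<notin> N \<Longrightarrow> (\<lambda>n::nat. g n t) \<longlonglongrightarrow> F t"
    using lebesgue_measurable_imp_measurable_on[OF F, of UNIV]
    unfolding measurable_on_def by auto
  define cut where "cut n t = min 1 (real n * infdist t (- ?U))" for n t
  have cut: "0 \<le> cut n t" "cut n t \<le> 1" "continuous_on UNIV (cut n)" for n t
    by (auto simp: cut_def[abs_def] infdist_nonneg intro!: continuous_intros)
  have cut_0: "cut n t = 0" if "t \<notin> ?U" for n t
    using that by (simp add: cut_def)
  have cut_lim: "(\<lambda>n. cut n t) \<longlonglongrightarrow> 1" if "t \<in> ?U" for t
  proof (rule tendsto_eventually)
    have "bounded ?U" by simp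
    then have "- ?U \<noteq> {}" by (metis Compl_empty_eq double_complement not_bounded_UNIV)
    then have pos: "infdist t (- ?U) > 0"
      using that by (intro infdist_pos_not_in_closed) auto
    show "\<forall>\<^sub>F n in sequentially. cut n t = 1"
      using eventually_ge_at_top[of "nat \<lceil>1 / infdist t (- ?U)\<rceil>"]
    proof eventually_elim
      case (elim n)
      then have "1 / infdist t (- ?U) \<le> real n" by linarith
      then show ?case using pos by (simp add: cut_def field_simps)
    qed
  qed
  \<comment> \<open>The projection is continuous and fixes the values of \<open>F\<close>.\<close>
  define K where "K = closest_point (cball 0 C :: complex set)"
  have K: "continuous_on S K" "cmod (K z) \<le> C" for z and S :: "complex set"
    unfolding K_def using C closest_point_in_set[of "cball 0 C" z]
    by (auto intro!: continuous_on_closest_point)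
  have KF: "K (F t) = F t" for t
    unfolding K_def using bound by (intro closest_point_self) simp
  define h where "h n t = of_real (cut n t) * K (g n t)" for n t
  have h: "continuous_on UNIV (h n)" for n
    unfolding h_def[abs_def]
    by (intro continuous_intros cut continuous_on_compose2[OF K(1)[of UNIV] g] subset_UNIV)
  have h0: "h n t = 0" if "t \<notin> ?U" for n t using cut_0[OF that] by (simp add: h_def)
  have hC: "cmod (h n t) \<le> C" for n t
    using mult_mono[OF cut(2) K(2)[of "g n t"], of n t] cut(1)[of n t]
    by (simp add: h_def norm_mult)
  have hF: "(\<lambda>n. h n t) \<longlonglongrightarrow> F t" if "t \<notin> N" "t \<notin> ?Q - ?U" for t
  proof (cases "t \<in> ?U")
    case True
    have "(\<lambda>n. K (g n t)) \<longlonglongrightarrow> K (F t)"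
      by (rule continuous_on_tendsto_compose[OF K(1)[of UNIV] lim]) (use that in auto)
    from tendsto_mult[OF tendsto_of_real[OF cut_lim[OF True]] this]
    show ?thesis by (simp add: h_def KF)
  next
    case False
    then show ?thesis using that F0 h0 by simp
  qed
  have bd: "(cmod (F t - h n t))\<^sup>2 \<le> (2 * C)\<^sup>2 * indicator ?Q t" for n t
  proof (cases "t \<in> ?Q")
    case True
    have "cmod (F t - h n t) \<le> 2 * C"
      using norm_triangle_ineq4[of "F t" "h n t"] bound[of t] hC[of n t] by linarith
    then have "(cmod (F t - h n t))\<^sup>2 \<le> (2 * C)\<^sup>2" by (intro power_mono) auto
    then show ?thesis using True by simp
  next
    case False
    then show ?thesis using F0 h0[of t n] UQ by auto
  qed
  have "(\<lambda>n. l2_norm (\<lambda>t. F t - h n t)) \<longlonglongrightarrow> 0"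
  proof (rule l2_norm_tendsto_0[where w = "\<lambda>t. (2 * C)\<^sup>2 * indicator ?Q t"])
    show "integrable lebesgue (\<lambda>t. (2 * C)\<^sup>2 * indicator ?Q t :: real)"
      by (intro integrable_mult_right integrable_real_indicator) (auto simp: emeasure_lborel_cbox_finite[unfolded infinity_ennreal_def])
    show "(\<lambda>t. F t - h n t) \<in> borel_measurable lebesgue" for n
      using F continuous_borel_measurable_lebesgue[OF h] by (intro borel_measurable_diff)
    have "negligible (?Q - ?U)" by (rule negligible_frontier_interval)
    with N have "negligible (N \<union> (?Q - ?U))" by (rule negligible_Un)
    then have "N \<union> (?Q - ?U) \<in> null_sets lebesgue" by (simp add: negligible_iff_null_sets)
    then show "AE t in lebesgue. (\<lambda>n. F t - h n t) \<longlonglongrightarrow> 0"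
    proof (rule AE_I'[OF _ subsetI], goal_cases)
      case (1 t)
      then have "\<not> (\<lambda>n. h n t) \<longlonglongrightarrow> F t" 
        using tendsto_diff[OF tendsto_const, of "\<lambda>n. h n t" "F t" sequentially "F t"] by auto
      then show ?case using hF by blast
    qed
  qed (rule bd)
  moreover have "square_integrable F"
  proof -
    have "square_integrable (\<lambda>t. indicator ?Q t * F t)"
      by (intro square_integrable_bounded_indicator(1)[OF F _ bound]) auto
    moreover have "(\<lambda>t. indicator ?Q t * F t) = F" using F0 by (intro ext) (auto simp: indicator_def)
    ultimately show ?thesis by simp
  qed
  moreover have "square_integrable (h n)" for n
  proof -
    have "square_integrable (\<lambda>t. indicator ?Q t * h n t)"
      by (intro square_integrable_bounded_indicator(1)[OF continuous_borel_measurable_lebesgue[OF h] _ hC]) auto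
    moreover have "(\<lambda>t. indicator ?Q t * h n t) = h n"
      using h0[of _ n] UQ by (intro ext) (auto simp: indicator_def)
    ultimately show ?thesis by simp
  qed
  ultimately show ?thesis
    using trig_approximable_continuous[OF b h h0] by (intro trig_approximable_limit[of F h])
qed

text \<open>Truncation of the values reduces the general case to the bounded one.\<close>

lemma trig_approximable_square_integrable:
  fixes F :: "real ^ 'n \<Rightarrow> complex"
  assumes b: "b > 0" and F: "square_integrable F"
    and F0: "\<And>t. t \<notin> cbox 0 (vec (1/b)) \<Longrightarrow> F t = 0"
  shows "trig_approximable b F"
proof -
  define G where "G n t = (if cmod (F t) \<le> real n then F t else 0)" for n t
  have F' [measurable]: "F \<in> borel_measurable lebesgue" and i: "integrable lebesgue (\<lambda>t. (cmod (F t))\<^sup>2)"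
    using F by (auto simp: square_integrable_def)
  have Gm [measurable]: "G n \<in> borel_measurable lebesgue" for n
    unfolding G_def[abs_def] by measurable
  have bd: "(cmod (G n t))\<^sup>2 \<le> (cmod (F t))\<^sup>2" "(cmod (F t - G n t))\<^sup>2 \<le> (cmod (F t))\<^sup>2" for n t
    by (auto simp: G_def)
  have "square_integrable (G n)" for n
    unfolding square_integrable_def
    by (intro conjI Gm Bochner_Integration.integrable_bound[OF i]) (use bd in auto)
  moreover have "trig_approximable b (G n)" for n
    by (rule trig_approximable_bounded[OF b Gm, of n n]) (auto simp: G_def F0)
  moreover have "(\<lambda>n. l2_norm (\<lambda>t. F t - G n t)) \<longlonglongrightarrow> 0"
  proof (rule l2_norm_tendsto_0[OF i _ _ bd(2)])
    show "AE t in lebesgue. (\<lambda>n. F t - G n t) \<longlonglongrightarrow> 0"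
    proof (intro AE_I2 tendsto_eventually)
      fix t
      show "\<forall>\<^sub>F n in sequentially. F t - G n t = 0"
        using eventually_ge_at_top[of "nat \<lceil>cmod (F t)\<rceil>"]
        by eventually_elim (auto simp: G_def nat_ceiling_le_eq)
    qed
  qed measurable
  ultimately show ?thesis
    by (intro trig_approximable_limit[OF F, of G])
qed

section \<open>Parseval's identity on a cube\<close>

definition cube_char :: "real \<Rightarrow> real ^ 'n \<Rightarrow> real ^ 'n \<Rightarrow> complex" where
  "cube_char b \<nu> = (\<lambda>t. indicator (cbox 0 (vec (1/b))) t * character \<nu> t)"

lemma cube_char_square_integrable: "square_integrable (cube_char b \<nu>)"
  unfolding cube_char_def
  by (rule trigonometric_square_integrable[OF trigonometric.character[of \<nu> UNIV]]) simp

lemma cube_char_orthogonal: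
  fixes \<nu> \<mu> :: "real ^ 'n"
  assumes b: "b > 0" and \<nu>: "\<nu> \<in> (\<lambda>x. b *\<^sub>R x) ` int_lattice" and \<mu>: "\<mu> \<in> (\<lambda>x. b *\<^sub>R x) ` int_lattice"
  shows "l2_inner (cube_char b \<nu>) (cube_char b \<mu>) = (if \<nu> = \<mu> then of_real ((1/b) ^ CARD('n)) else 0)"
proof -
  let ?Q = "cbox 0 (vec (1/b)) :: (real ^ 'n) set"
  have "(\<nu> - \<mu>) \<in> (\<lambda>x. b *\<^sub>R x) ` int_lattice"
    using scaled_int_lattice_add[OF \<nu> scaled_int_lattice_minus[OF \<mu>]] by simp
  then obtain k where k: "k \<in> int_lattice" "\<nu> - \<mu> = b *\<^sub>R k" by blast
  have i: "(\<nu> - \<mu>) $ i * (1/b) \<in> \<int>" for i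
    using k b by (simp add: int_lattice_def)
  have "cube_char b \<nu> t * cnj (cube_char b \<mu> t) = indicator ?Q t * character (\<nu> - \<mu>) t" for t
    using character_add_left[of \<nu> "- \<mu>" t] by (simp add: cube_char_def cnj_character indicator_def)
  then have "l2_inner (cube_char b \<nu>) (cube_char b \<mu>) = (LINT t|lebesgue. indicator ?Q t * character (\<nu> - \<mu>) t)"
    by (simp add: l2_inner_def)
  also have "\<dots> = (if \<nu> - \<mu> = 0 then of_real ((1/b) ^ CARD('n)) else 0)"
    by (rule integral_character_cube) (use b i in auto)
  finally show ?thesis by simp
qed

text \<open>A trigonometric polynomial on the cube is a combination of finitely many characters; only the
  consequence that anything orthogonal to those characters is orthogonal to it is recorded.\<close>

lemma trigonometric_finite_test:
  assumes "trigonometric \<Gamma> p"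
  shows "\<exists>M. finite M \<and> M \<subseteq> \<Gamma> \<and>
    (\<forall>R. square_integrable R \<longrightarrow> (\<forall>\<nu>\<in>M. l2_inner (cube_char b \<nu>) R = 0) \<longrightarrow>
       l2_inner (\<lambda>t. indicator (cbox 0 (vec (1/b))) t * p t) R = 0)"
    (is "\<exists>M. finite M \<and> M \<subseteq> \<Gamma> \<and> (\<forall>R. _ \<longrightarrow> _ \<longrightarrow> l2_inner (\<lambda>t. indicator ?Q t * p t) R = 0)")
  using assms
proof induction
  case (character \<nu>)
  then show ?case by (intro exI[of _ "{\<nu>}"]) (auto simp: cube_char_def)
next
  case (add p q)
  obtain M where M: "finite M" "M \<subseteq> \<Gamma>" "\<And>R. square_integrable R \<Longrightarrow>
      (\<forall>\<nu>\<in>M. l2_inner (cube_char b \<nu>) R = 0) \<Longrightarrow> l2_inner (\<lambda>t. indicator ?Q t * p t) R = 0"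
    using add.IH(1) by auto
  obtain N where N: "finite N" "N \<subseteq> \<Gamma>" "\<And>R. square_integrable R \<Longrightarrow>
      (\<forall>\<nu>\<in>N. l2_inner (cube_char b \<nu>) R = 0) \<Longrightarrow> l2_inner (\<lambda>t. indicator ?Q t * q t) R = 0"
    using add.IH(2) by auto
  have "l2_inner (\<lambda>t. indicator ?Q t * (p t + q t)) R = 0"
    if "square_integrable R" "\<forall>\<nu>\<in>M \<union> N. l2_inner (cube_char b \<nu>) R = 0" for R
    using M(3)[OF that(1)] N(3)[OF that(1)] that(2)
      l2_inner_add_left[OF trigonometric_square_integrable[OF add.hyps(1), of 0 "vec (1/b)"]
        trigonometric_square_integrable[OF add.hyps(2), of 0 "vec (1/b)"] that(1)]
    by (simp add: ring_distribs)
  then show ?case using M(1,2) N(1,2) by (intro exI[of _ "M \<union> N"]) auto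
next
  case (cmult p c)
  then obtain M where M: "finite M" "M \<subseteq> \<Gamma>" "\<And>R. square_integrable R \<Longrightarrow>
      (\<forall>\<nu>\<in>M. l2_inner (cube_char b \<nu>) R = 0) \<Longrightarrow> l2_inner (\<lambda>t. indicator ?Q t * p t) R = 0"
    by auto
  then show ?case
    using l2_inner_cmult_left[of c "\<lambda>t. indicator ?Q t * p t"]
    by (intro exI[of _ M]) (simp add: mult.left_commute)
qed

text \<open>Parseval's identity.  The remainder \<open>R M\<close> after projecting \<open>F\<close> to the characters in \<open>M\<close> is
  orthogonal to them, so that \<open>\<parallel>R M\<parallel>\<^sup>2 = \<langle>F - p, R M\<rangle>\<close> for each trigonometric polynomial \<open>p\<close> with
  frequencies in \<open>M\<close>.  By Cauchy-Schwarz the remainder is no longer than \<open>F - p\<close>, which can be made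
  arbitrarily short.\<close>

theorem Parseval_cube:
  fixes F G :: "real ^ 'n \<Rightarrow> complex"
  assumes b: "b > 0" and F: "square_integrable F" and G: "square_integrable G"
    and F0: "\<And>t. t \<notin> cbox 0 (vec (1/b)) \<Longrightarrow> F t = 0"
  shows "((\<lambda>\<nu>. l2_inner F (cube_char b \<nu>) * l2_inner (cube_char b \<nu>) G) has_sum
     of_real ((1/b) ^ CARD('n)) * l2_inner F G) ((\<lambda>x. b *\<^sub>R x) ` int_lattice)"
proof -
  let ?\<Gamma> = "(\<lambda>x. b *\<^sub>R x) ` int_lattice :: (real ^ 'n) set"
  let ?Q = "cbox 0 (vec (1/b)) :: (real ^ 'n) set"
  define V :: real where "V = (1/b) ^ CARD('n)"
  have V: "V > 0" using b by (simp add: V_def)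
  define P where "P M t = (\<Sum>\<nu>\<in>M. (l2_inner F (cube_char b \<nu>) / of_real V) * cube_char b \<nu> t)" for M t
  have P: "square_integrable (P M)" for M
    unfolding P_def[abs_def]
    by (intro square_integrable_sum square_integrable_cmult cube_char_square_integrable)
  have P_inner: "l2_inner (P M) R
      = (\<Sum>\<nu>\<in>M. l2_inner F (cube_char b \<nu>) * l2_inner (cube_char b \<nu>) R) / of_real V"
    if "square_integrable R" for M R
  proof -
    have "l2_inner (P M) R
        = (\<Sum>\<nu>\<in>M. l2_inner (\<lambda>t. (l2_inner F (cube_char b \<nu>) / of_real V) * cube_char b \<nu> t) R)"
      unfolding P_def[abs_def]
      by (intro l2_inner_sum_left square_integrable_cmult cube_char_square_integrable that)
    then show ?thesis by (simp only: l2_inner_cmult_left) (simp add: sum_divide_distrib)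
  qed
  define R where "R M t = F t - P M t" for M t
  have R_eq: "R M = (\<lambda>t. F t - P M t)" for M
    by (rule ext) (simp add: R_def)
  have R: "square_integrable (R M)" for M
    unfolding R_eq by (intro square_integrable_diff F P)
  have R_orth: "l2_inner (R M) (cube_char b \<nu>) = 0" if "finite M" "M \<subseteq> ?\<Gamma>" "\<nu> \<in> M" for M \<nu>
  proof -
    have "l2_inner (P M) (cube_char b \<nu>)
        = (\<Sum>\<mu>\<in>M. if \<mu> = \<nu> then l2_inner F (cube_char b \<mu>) * of_real V else 0) / of_real V"
      unfolding P_inner[OF cube_char_square_integrable]
      using that by (intro arg_cong2[of _ _ _ _ "(/)"] sum.cong refl)
        (auto simp: cube_char_orthogonal[OF b] V_def subset_iff)
    also have "\<dots> = l2_inner F (cube_char b \<nu>)"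
      using that V by (simp add: sum.delta')
    finally show ?thesis
      unfolding R_eq by (simp add: l2_inner_diff_left F P cube_char_square_integrable)
  qed
  have small: "\<exists>M0. finite M0 \<and> M0 \<subseteq> ?\<Gamma> \<and> (\<forall>M. finite M \<longrightarrow> M0 \<subseteq> M \<longrightarrow> M \<subseteq> ?\<Gamma> \<longrightarrow> l2_norm (R M) < e)"
    if "e > 0" for e
  proof -
    obtain p where p: "trigonometric ?\<Gamma> p" and pe: "l2_norm (\<lambda>t. F t - indicator ?Q t * p t) < e"
      using trig_approximable_square_integrable[OF b F F0] \<open>e > 0\<close> unfolding trig_approximable_def by blast
    let ?p = "\<lambda>t. indicator ?Q t * p t"
    note sp = trigonometric_square_integrable[OF p, of 0 "vec (1/b)"]
    from trigonometric_finite_test[OF p, of b] obtain M0 where M0: "finite M0" "M0 \<subseteq> ?\<Gamma>"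
      "\<forall>R. square_integrable R \<longrightarrow> (\<forall>\<nu>\<in>M0. l2_inner (cube_char b \<nu>) R = 0) \<longrightarrow> l2_inner ?p R = 0"
      by (elim exE conjE)
    have "l2_norm (R M) < e" if M: "finite M" "M0 \<subseteq> M" "M \<subseteq> ?\<Gamma>" for M
    proof -
      have orth: "l2_inner (cube_char b \<nu>) (R M) = 0" if "\<nu> \<in> M" for \<nu>
        using R_orth[OF M(1,3) that] l2_inner_commute[of "cube_char b \<nu>" "R M"] by simp
      have "l2_inner (P M) (R M) = 0" by (simp add: P_inner[OF R] orth)
      moreover have "l2_inner ?p (R M) = 0" using M0(3) R orth M by blast
      ultimately have "l2_inner (R M) (R M) = l2_inner (\<lambda>t. F t - ?p t) (R M)"
        using l2_inner_diff_left[OF F P[of M] R[of M]] l2_inner_diff_left[OF F sp R[of M]]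
        by (simp add: R_eq[symmetric])
      then have "(l2_norm (R M))\<^sup>2 = cmod (l2_inner (\<lambda>t. F t - ?p t) (R M))"
        using l2_inner_self[of "R M"] by (metis abs_power2 norm_of_real)
      also have "\<dots> \<le> l2_norm (\<lambda>t. F t - ?p t) * l2_norm (R M)"
        by (rule l2_Cauchy_Schwarz[OF square_integrable_diff[OF F sp] R])
      finally have "l2_norm (R M) \<le> l2_norm (\<lambda>t. F t - ?p t)"
        using l2_norm_nonneg[of "R M"] l2_norm_nonneg[of "\<lambda>t. F t - ?p t"]
        by (cases "l2_norm (R M) = 0") (simp_all add: power2_eq_square mult_le_cancel_right)
      then show ?thesis using pe by linarith
    qed
    then show ?thesis using M0(1,2) by blast
  qed
  show ?thesis
    unfolding has_sum_def V_def[symmetric]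
  proof (rule tendstoI)
    fix e :: real assume "e > 0"
    \<comment> \<open>The summand \<open>1\<close> keeps the denominator positive when \<open>G\<close> vanishes.\<close>
    define e' where "e' = e / (V * (l2_norm G + 1))"
    have pos: "V * (l2_norm G + 1) > 0" using V by (simp add: add_nonneg_pos)
    have "e' > 0" using \<open>e > 0\<close> pos by (simp add: e'_def)
    then obtain M0 where M0: "finite M0" "M0 \<subseteq> ?\<Gamma>"
      "\<And>M. finite M \<Longrightarrow> M0 \<subseteq> M \<Longrightarrow> M \<subseteq> ?\<Gamma> \<Longrightarrow> l2_norm (R M) < e'"
      using small[of e'] by blast
    have "dist (\<Sum>\<nu>\<in>M. l2_inner F (cube_char b \<nu>) * l2_inner (cube_char b \<nu>) G)
        (of_real V * l2_inner F G) < e" if "finite M" "M0 \<subseteq> M" "M \<subseteq> ?\<Gamma>" for M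
    proof -
      have "of_real V * l2_inner F G - (\<Sum>\<nu>\<in>M. l2_inner F (cube_char b \<nu>) * l2_inner (cube_char b \<nu>) G)
          = of_real V * l2_inner (R M) G"
        using V P_inner[OF G, of M]
        by (simp add: R_eq l2_inner_diff_left F P G right_diff_distrib)
      then have "dist (\<Sum>\<nu>\<in>M. l2_inner F (cube_char b \<nu>) * l2_inner (cube_char b \<nu>) G) (of_real V * l2_inner F G)
          = V * cmod (l2_inner (R M) G)"
        using V by (simp add: dist_norm norm_minus_commute norm_mult)
      also have "\<dots> \<le> V * (l2_norm (R M) * l2_norm G)"
        using V l2_Cauchy_Schwarz[OF R G, of M] by simp
      also have "\<dots> \<le> V * (l2_norm (R M) * (l2_norm G + 1))"
        using V by (intro mult_left_mono) auto
      also have "\<dots> < V * (e' * (l2_norm G + 1))"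
        using V M0(3)[OF that] by (intro mult_strict_left_mono mult_strict_right_mono) (auto simp: add_nonneg_pos)
      also have "\<dots> = e"
      proof -
        have "l2_norm G + 1 \<noteq> 0" using l2_norm_nonneg[of G] by linarith
        then show ?thesis using V by (simp add: e'_def)
      qed
      finally show ?thesis .
    qed
    then show "\<forall>\<^sub>F M in finite_subsets_at_top ?\<Gamma>.
        dist (\<Sum>\<nu>\<in>M. l2_inner F (cube_char b \<nu>) * l2_inner (cube_char b \<nu>) G) (of_real V * l2_inner F G) < e"
      unfolding eventually_finite_subsets_at_top using M0(1,2) by blast
  qed
qed

section \<open>Tilings by lattice translates of a cube\<close>

definition half_open_cube :: "real \<Rightarrow> (real ^ 'n) set" where
  "half_open_cube a = {t. \<forall>i. 0 \<le> t $ i \<and> t $ i < a}"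

lemma half_open_cube_borel: "half_open_cube a \<in> sets borel"
proof -
  have "half_open_cube a = (\<Inter>i. {t :: real ^ 'n. 0 \<le> t $ i} \<inter> {t. t $ i < a})"
    by (auto simp: half_open_cube_def)
  also have "\<dots> \<in> sets borel"
    by (intro sets.finite_INT sets.Int borel_closed borel_open closed_Collect_le open_Collect_less
        continuous_intros) auto
  finally show ?thesis .
qed

lemma half_open_cube_subset:
  assumes "a \<le> c"
  shows "half_open_cube a \<subseteq> cbox 0 (vec c)"
proof
  fix t :: "real ^ 'n" assume "t \<in> half_open_cube a"
  then have "0 \<le> t $ i \<and> t $ i < a" for i by (simp add: half_open_cube_def)
  then have "0 \<le> t $ i \<and> t $ i \<le> c" for i using assms by (meson less_imp_le order_trans)
  then show "t \<in> cbox 0 (vec c)" by (simp add: mem_box_cart)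
qed

text \<open>The half-open cube differs from the closed one in a null set, and over the latter the trivial
  character has been integrated.\<close>

lemma integral_indicator_half_open_cube:
  assumes "a > 0"
  shows "(LINT t|lebesgue. indicator (half_open_cube a :: (real ^ 'n) set) t) = (of_real (a ^ CARD('n)) :: complex)"
proof -
  let ?Q = "cbox 0 (vec a) :: (real ^ 'n) set" and ?U = "box 0 (vec a) :: (real ^ 'n) set"
  have P [measurable]: "half_open_cube a \<in> sets (lebesgue :: (real ^ 'n) measure)"
    by (intro sets_completionI_sets) (simp add: half_open_cube_borel)
  have "negligible (?Q - ?U)" by (rule negligible_frontier_interval)
  then have "?Q - ?U \<in> null_sets lebesgue" by (simp add: negligible_iff_null_sets)
  moreover have "?U \<subseteq> half_open_cube a"
    by (auto simp: half_open_cube_def mem_box_cart less_imp_le)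
  then have "{t \<in> space lebesgue. indicator (half_open_cube a) t \<noteq> (indicator ?Q t :: complex)} \<subseteq> ?Q - ?U"
    using half_open_cube_subset[of a a] by (auto simp: indicator_def split: if_splits)
  ultimately have "AE t in lebesgue. indicator (half_open_cube a) t = (indicator ?Q t :: complex)"
    by (rule AE_I')
  then have "(LINT t|lebesgue. indicator (half_open_cube a :: (real ^ 'n) set) t)
      = (LINT t|lebesgue. indicator ?Q t :: complex)"
    by (intro integral_cong_AE borel_measurable_indicator P) auto
  also have "\<dots> = of_real (a ^ CARD('n))"
    using integral_character_cube[OF assms, of "0 :: real ^ 'n"] by simp
  finally show ?thesis .
qed

lemma scaled_int_lattice_enumeration:
  assumes "a \<noteq> 0"
  obtains e :: "nat \<Rightarrow> real ^ 'n" where "bij_betw e UNIV ((\<lambda>x. a *\<^sub>R x) ` int_lattice)"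
proof -
  let ?L = "int_lattice :: (real ^ 'n) set"
  have "?L \<subseteq> range (\<lambda>z :: int ^ 'n. \<chi> i. of_int (z $ i))"
  proof
    fix x :: "real ^ 'n" assume "x \<in> ?L"
    then have "x = (\<chi> i. of_int ((\<chi> i. \<lfloor>x $ i\<rfloor>) $ i))"
      by (simp add: vec_eq_iff int_lattice_def)
    then show "x \<in> range (\<lambda>z :: int ^ 'n. \<chi> i. of_int (z $ i))" by blast
  qed
  then have "countable ?L" by (rule countable_subset) (intro countable_image countableI_type)
  moreover have "infinite ?L"
  proof
    assume "finite ?L"
    moreover have "range (\<lambda>n::nat. vec (real n) :: real ^ 'n) \<subseteq> ?L" by (auto simp: int_lattice_def)
    ultimately have "finite (range (\<lambda>n::nat. vec (real n) :: real ^ 'n))" by (rule rev_finite_subset)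
    moreover have "inj (\<lambda>n::nat. vec (real n) :: real ^ 'n)" by (auto simp: inj_def vec_eq_iff)
    ultimately show False by (auto dest: finite_imageD)
  qed
  moreover have "inj_on (\<lambda>x. a *\<^sub>R x) ?L" using assms by (auto simp: inj_on_def)
  ultimately have "countable ((\<lambda>x. a *\<^sub>R x) ` ?L)" "infinite ((\<lambda>x. a *\<^sub>R x) ` ?L)"
    by (auto dest: finite_imageD)
  then show ?thesis using that bij_betw_from_nat_into by blast
qed

text \<open>The translates of the half-open cube by \<open>a \<int>\<^sup>n\<close> partition the space: the lattice vector that moves
  \<open>t\<close> into the cube has the coordinates \<open>- a \<lfloor>t\<^sub>i / a\<rfloor>\<close>.\<close>

lemma tiling_integral:
  fixes \<phi> :: "real ^ 'n \<Rightarrow> complex"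
  assumes a: "a > 0" and \<phi>: "integrable lebesgue \<phi>"
    and S: "((\<lambda>k. LINT t|lebesgue. indicator (half_open_cube a) t * \<phi> (t - k)) has_sum S)
      ((\<lambda>x. a *\<^sub>R x) ` int_lattice)"
  shows "S = (LINT t|lebesgue. \<phi> t)"
proof -
  let ?\<Gamma> = "(\<lambda>x. a *\<^sub>R x) ` int_lattice :: (real ^ 'n) set"
  let ?P = "half_open_cube a :: (real ^ 'n) set"
  obtain e :: "nat \<Rightarrow> real ^ 'n" where e: "bij_betw e UNIV ?\<Gamma>"
    using scaled_int_lattice_enumeration[of a] a by blast
  define A where "A n = {t. t + e n \<in> ?P}" for n
  have "A n = (\<lambda>t. t + e n) -` ?P \<inter> space borel" for n by (auto simp: A_def)
  moreover have "(\<lambda>t. t + e n) \<in> borel \<rightarrow>\<^sub>M borel" for n by measurable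
  ultimately have A_borel: "A n \<in> sets borel" for n
    using measurable_sets[OF _ half_open_cube_borel] by metis
  then have A: "A n \<in> sets lebesgue" for n by (intro sets_completionI_sets) simp
  have uniq: "k $ i = a * - of_int \<lfloor>t $ i / a\<rfloor>" if "k \<in> ?\<Gamma>" "t + k \<in> ?P" for t k i
  proof -
    obtain z where z: "z \<in> int_lattice" "k = a *\<^sub>R z" using \<open>k \<in> ?\<Gamma>\<close> by blast
    then obtain m where m: "z $ i = of_int m" by (auto simp: int_lattice_def elim: Ints_cases)
    have "0 \<le> t $ i + a * z $ i" "t $ i + a * z $ i < a"
      using that(2) by (simp_all add: half_open_cube_def z(2))
    then have "0 \<le> t $ i + a * of_int m" "t $ i + a * of_int m < a"
      unfolding m by simp_all
    then have "- of_int m * a \<le> t $ i" "t $ i < (- of_int m + 1) * a"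
      by (simp_all add: algebra_simps)
    then have "- of_int m \<le> t $ i / a" "t $ i / a < - of_int m + 1"
      using a by (simp_all only: pos_le_divide_eq pos_divide_less_eq)
    then have "\<lfloor>t $ i / a\<rfloor> = - m" by (intro floor_unique) auto
    then show ?thesis using z m by simp
  qed
  have disj: "A i \<inter> A j = {}" if "i \<noteq> j" for i j
  proof (rule ccontr)
    assume "A i \<inter> A j \<noteq> {}"
    then obtain t where "t + e i \<in> ?P" "t + e j \<in> ?P" by (auto simp: A_def)
    moreover have "e i \<in> ?\<Gamma>" "e j \<in> ?\<Gamma>" using bij_betw_apply[OF e] by blast+
    ultimately have "e i = e j" using uniq[of "e i" t] uniq[of "e j" t] by (simp add: vec_eq_iff)
    then show False using bij_betw_imp_inj_on[OF e] that by (auto dest: injD)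
  qed
  have cover: "(\<Union>n. A n) = UNIV"
  proof (intro equalityI subset_UNIV subsetI)
    fix t :: "real ^ 'n"
    define z :: "real ^ 'n" where "z = (\<chi> i. - of_int \<lfloor>t $ i / a\<rfloor>)"
    have "z \<in> int_lattice" by (simp add: int_lattice_def z_def)
    then have "a *\<^sub>R z \<in> ?\<Gamma>" by blast
    then obtain n where n: "e n = a *\<^sub>R z" using bij_betw_imp_surj_on[OF e] by (metis imageE)
    have "0 \<le> t $ i + a * - of_int \<lfloor>t $ i / a\<rfloor> \<and> t $ i + a * - of_int \<lfloor>t $ i / a\<rfloor> < a" for i
    proof -
      have "of_int \<lfloor>t $ i / a\<rfloor> \<le> t $ i / a" "t $ i / a < of_int \<lfloor>t $ i / a\<rfloor> + 1"
        by linarith+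
      then have "of_int \<lfloor>t $ i / a\<rfloor> * a \<le> t $ i" "t $ i < (of_int \<lfloor>t $ i / a\<rfloor> + 1) * a"
        using a by (simp_all only: pos_le_divide_eq pos_divide_less_eq)
      then show ?thesis by (simp add: algebra_simps)
    qed
    then have "t + e n \<in> ?P" by (simp add: n half_open_cube_def z_def)
    then show "t \<in> (\<Union>n. A n)" by (auto simp: A_def)
  qed
  have tile: "(LINT t|lebesgue. indicator ?P t * \<phi> (t - e n)) = (LINT t:A n|lebesgue. \<phi> t)" for n
  proof -
    have "(LINT t|lebesgue. indicator ?P t * \<phi> (t - e n))
        = (LINT t|lebesgue. (\<lambda>s. indicator (A n) s *\<^sub>R \<phi> s) (t - e n))"
      by (intro Bochner_Integration.integral_cong refl) (simp add: A_def indicator_def)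
    also have "\<dots> = (LINT t|lebesgue. indicator (A n) t *\<^sub>R \<phi> t)"
      by (rule integral_lebesgue_translate) (use A \<phi> in \<open>auto intro!: borel_measurable_scaleR\<close>)
    finally show ?thesis by (simp add: set_lebesgue_integral_def)
  qed
  have "((\<lambda>n. LINT t|lebesgue. indicator ?P t * \<phi> (t - e n)) has_sum S) UNIV"
    using has_sum_reindex_bij_betw[OF e, of "\<lambda>k. LINT t|lebesgue. indicator ?P t * \<phi> (t - k)" S] S by simp
  then have "(\<lambda>n. LINT t:A n|lebesgue. \<phi> t) sums S"
    unfolding tile by (rule has_sum_imp_sums)
  then have "S = (\<Sum>n. LINT t:A n|lebesgue. \<phi> t)" by (rule sums_unique)
  also have "\<dots> = (LINT t:(\<Union>n. A n)|lebesgue. \<phi> t)"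
    by (rule lebesgue_integral_countable_add[symmetric])
       (use A disj \<phi> in \<open>auto simp: cover set_integrable_def\<close>)
  also have "\<dots> = (LINT t|lebesgue. \<phi> t)"
    by (simp add: cover set_lebesgue_integral_def)
  finally show ?thesis .
qed

section \<open>Time-frequency shifts\<close>

lemma tf_shift_eq: "tf_shift z f = (\<lambda>t. character (snd z) t * f (t - fst z))"
  by (simp add: tf_shift_def character_def)

lemma tf_shift_zero [simp]: "tf_shift 0 f = f"
  by (simp add: tf_shift_eq)

lemma tf_shift_square_integrable:
  assumes "square_integrable f"
  shows "square_integrable (tf_shift z f)"
  unfolding tf_shift_eq
  by (intro square_integrable_bounded_mult square_integrable_translate assms) auto

lemma character_mult_cnj: "character \<nu> t * cnj (character \<nu> t) = 1"
  by (simp flip: complex_norm_square)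

lemma l2_inner_tf_shift:
  assumes "square_integrable f" "square_integrable g"
  shows "l2_inner (tf_shift z f) (tf_shift z g) = l2_inner f g"
proof -
  have "tf_shift z f t * cnj (tf_shift z g t) = f (t - fst z) * cnj (g (t - fst z))" for t
  proof -
    have "tf_shift z f t * cnj (tf_shift z g t)
        = (character (snd z) t * cnj (character (snd z) t)) * (f (t - fst z) * cnj (g (t - fst z)))"
      by (simp add: tf_shift_eq)
    then show ?thesis by (simp add: character_mult_cnj)
  qed
  then show ?thesis
    using integral_lebesgue_translate[OF borel_measurable_integrable[OF
        square_integrable_integrable_mult_cnj[OF assms]], of "fst z"]
    by (simp add: l2_inner_def)
qed

text \<open>Time-frequency shifts form a group up to unimodular factors.\<close>

lemma tf_shift_tf_shift:
  "tf_shift z (tf_shift w f) = (\<lambda>t. character (- snd w) (fst z) * tf_shift (z + w) f t)"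
proof
  fix t
  have "character (snd w) (t - fst z) = character (- snd w) (fst z) * character (snd w) t"
    by (simp add: character_def inner_diff_right exp_diff exp_minus right_diff_distrib field_simps)
  then show "tf_shift z (tf_shift w f) t = character (- snd w) (fst z) * tf_shift (z + w) f t"
    by (simp add: tf_shift_eq character_add_left diff_diff_eq)
qed

lemma l2_inner_tf_shift_tf_shift:
  assumes u: "square_integrable u" and g: "square_integrable g"
  shows "l2_inner u (tf_shift w g) = cnj (character (- snd w) (fst z)) * l2_inner (tf_shift z u) (tf_shift (z + w) g)"
proof -
  have "l2_inner u (tf_shift w g) = l2_inner (tf_shift z u) (tf_shift z (tf_shift w g))"
    by (rule l2_inner_tf_shift[symmetric, OF u tf_shift_square_integrable[OF g]])
  also have "\<dots> = cnj (l2_inner (\<lambda>t. character (- snd w) (fst z) * tf_shift (z + w) g t) (tf_shift z u))"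
    unfolding tf_shift_tf_shift by (rule l2_inner_commute)
  also have "\<dots> = cnj (character (- snd w) (fst z)) * l2_inner (tf_shift z u) (tf_shift (z + w) g)"
    unfolding l2_inner_cmult_left
    by (simp add: l2_inner_commute[of "tf_shift z u" "tf_shift (z + w) g"])
  finally show ?thesis .
qed

lemma rect_lattice_add: "z \<in> rect_lattice a b \<Longrightarrow> w \<in> rect_lattice a b \<Longrightarrow> z + w \<in> rect_lattice a b"
  unfolding rect_lattice_def
  by (cases z, cases w) (auto simp flip: scaleR_add_right intro: int_lattice_add)

lemma rect_lattice_minus: "z \<in> rect_lattice a b \<Longrightarrow> - z \<in> rect_lattice a b"
  unfolding rect_lattice_def
  by (cases z) (auto simp flip: scaleR_minus_right intro: int_lattice_minus)

section \<open>Gabor frames and biorthogonal systems\<close>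

text \<open>A system \<open>h\<close> biorthogonal to a frame reproduces every \<open>f\<close>.  The partial sum
  \<open>v F = \<Sum>\<^bsub>z\<in>F\<^esub> \<langle>f, g\<^sub>z\<rangle> h\<^sub>z / c\<close> has the same frame coefficients as \<open>f\<close> at the points of \<open>F\<close> and vanishing
  ones elsewhere.  The lower frame bound therefore controls \<open>\<parallel>f - v F\<parallel>\<^sup>2\<close> by a tail of the convergent
  series \<open>\<Sum>\<^sub>z \<bar>\<langle>f, g\<^sub>z\<rangle>\<bar>\<^sup>2\<close>.\<close>

lemma biorthogonal_expansion:
  assumes g: "square_integrable g" and frame: "gabor_frame g \<Lambda>"
    and h: "\<And>z. z \<in> \<Lambda> \<Longrightarrow> square_integrable (h z)" and c: "c \<noteq> 0"
    and biorth: "\<And>z w. z \<in> \<Lambda> \<Longrightarrow> w \<in> \<Lambda> \<Longrightarrow> l2_inner (h z) (tf_shift w g) = (if z = w then c else 0)"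
    and f: "square_integrable f" and k: "square_integrable k"
  shows "((\<lambda>z. l2_inner f (tf_shift z g) * l2_inner (h z) k) has_sum c * l2_inner f k) \<Lambda>"
proof -
  obtain A where A: "A > 0"
    and summable: "\<And>f. square_integrable f \<Longrightarrow> (\<lambda>z. (cmod (l2_inner f (tf_shift z g)))\<^sup>2) summable_on \<Lambda>"
    and lower: "\<And>f. square_integrable f \<Longrightarrow>
      A * (l2_norm f)\<^sup>2 \<le> (\<Sum>\<^sub>\<infinity>z\<in>\<Lambda>. (cmod (l2_inner f (tf_shift z g)))\<^sup>2)"
    using frame unfolding gabor_frame_def by blast
  note shift = tf_shift_square_integrable[OF g]
  define s where "s z = (cmod (l2_inner f (tf_shift z g)))\<^sup>2" for z
  define v where "v F t = (\<Sum>z\<in>F. (l2_inner f (tf_shift z g) / c) * h z t)" for F t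
  define R where "R F t = f t - v F t" for F t
  have R_eq: "R F = (\<lambda>t. f t - v F t)" for F by (rule ext) (simp add: R_def)
  have v: "square_integrable (v F)" if "F \<subseteq> \<Lambda>" for F
    unfolding v_def[abs_def] by (intro square_integrable_sum square_integrable_cmult h) (use that in auto)
  have R: "square_integrable (R F)" if "F \<subseteq> \<Lambda>" for F
    unfolding R_eq by (intro square_integrable_diff f v that)
  have v_inner: "l2_inner (v F) u = (\<Sum>z\<in>F. l2_inner f (tf_shift z g) * l2_inner (h z) u) / c"
    if "F \<subseteq> \<Lambda>" "square_integrable u" for F u
  proof -
    have "l2_inner (v F) u = (\<Sum>z\<in>F. l2_inner (\<lambda>t. (l2_inner f (tf_shift z g) / c) * h z t) u)"
      unfolding v_def[abs_def]
      by (intro l2_inner_sum_left square_integrable_cmult h that) (use that in auto)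
    then show ?thesis by (simp only: l2_inner_cmult_left) (simp add: sum_divide_distrib)
  qed
  have R_inner: "l2_inner (R F) (tf_shift w g) = (if w \<in> F then 0 else l2_inner f (tf_shift w g))"
    if "finite F" "F \<subseteq> \<Lambda>" "w \<in> \<Lambda>" for F w
  proof -
    have "l2_inner (v F) (tf_shift w g) = (\<Sum>z\<in>F. if z = w then l2_inner f (tf_shift z g) * c else 0) / c"
      unfolding v_inner[OF that(2) shift]
      by (intro arg_cong2[of _ _ _ _ "(/)"] sum.cong refl) (simp add: biorth[OF subsetD[OF that(2)] that(3)])
    also have "\<dots> = (if w \<in> F then l2_inner f (tf_shift w g) else 0)"
      using that c by simp
    finally show ?thesis
      unfolding R_eq by (simp add: l2_inner_diff_left f v that shift)
  qed
  have R_bound: "(l2_norm (R F))\<^sup>2 \<le> (infsum s \<Lambda> - sum s F) / A" if F: "finite F" "F \<subseteq> \<Lambda>" for F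
  proof -
    have "A * (l2_norm (R F))\<^sup>2 \<le> (\<Sum>\<^sub>\<infinity>z\<in>\<Lambda>. (cmod (l2_inner (R F) (tf_shift z g)))\<^sup>2)"
      by (rule lower[OF R[OF F(2)]])
    also have "\<dots> = infsum s (\<Lambda> - F)"
      by (rule infsum_cong_neutral) (auto simp: R_inner[OF F] s_def)
    also have "\<dots> = infsum s \<Lambda> - infsum s F"
      by (rule infsum_Diff) (use F summable[OF f] in \<open>auto simp: s_def[abs_def]\<close>)
    finally show ?thesis using A F by (simp add: pos_le_divide_eq mult.commute)
  qed
  have "(sum s \<longlongrightarrow> infsum s \<Lambda>) (finite_subsets_at_top \<Lambda>)"
    using summable[OF f] infsum_tendsto[of s \<Lambda>] by (simp add: s_def[abs_def])
  then have "((\<lambda>F. (infsum s \<Lambda> - sum s F) / A) \<longlongrightarrow> (infsum s \<Lambda> - infsum s \<Lambda>) / A) (finite_subsets_at_top \<Lambda>)"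
    using A by (intro tendsto_intros) auto
  then have "((\<lambda>F. sqrt ((infsum s \<Lambda> - sum s F) / A) * (cmod c * l2_norm k)) \<longlongrightarrow> sqrt 0 * (cmod c * l2_norm k))
      (finite_subsets_at_top \<Lambda>)"
    by (intro tendsto_mult_right tendsto_real_sqrt) simp
  then have lim: "((\<lambda>F. sqrt ((infsum s \<Lambda> - sum s F) / A) * (cmod c * l2_norm k)) \<longlongrightarrow> 0)
      (finite_subsets_at_top \<Lambda>)" by simp
  have "cmod ((\<Sum>z\<in>F. l2_inner f (tf_shift z g) * l2_inner (h z) k) - c * l2_inner f k)
      \<le> sqrt ((infsum s \<Lambda> - sum s F) / A) * (cmod c * l2_norm k)" if F: "finite F" "F \<subseteq> \<Lambda>" for F
  proof -
    have "c * l2_inner f k - (\<Sum>z\<in>F. l2_inner f (tf_shift z g) * l2_inner (h z) k) = c * l2_inner (R F) k"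
      using v_inner[OF F(2) k] c
      by (simp add: R_eq l2_inner_diff_left f v F k right_diff_distrib)
    then have "cmod ((\<Sum>z\<in>F. l2_inner f (tf_shift z g) * l2_inner (h z) k) - c * l2_inner f k)
        = cmod c * cmod (l2_inner (R F) k)"
      by (subst norm_minus_commute) (simp only: norm_mult)
    also have "\<dots> \<le> cmod c * (l2_norm (R F) * l2_norm k)"
      by (intro mult_left_mono l2_Cauchy_Schwarz R F k) auto
    also have "\<dots> \<le> cmod c * (sqrt ((infsum s \<Lambda> - sum s F) / A) * l2_norm k)"
      by (intro mult_left_mono mult_right_mono real_le_rsqrt R_bound F) auto
    finally show ?thesis by (simp add: mult_ac)
  qed
  then have "\<forall>\<^sub>F F in finite_subsets_at_top \<Lambda>.
      cmod ((\<Sum>z\<in>F. l2_inner f (tf_shift z g) * l2_inner (h z) k) - c * l2_inner f k)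
      \<le> sqrt ((infsum s \<Lambda> - sum s F) / A) * (cmod c * l2_norm k)"
    by (intro eventually_finite_subsets_at_top_weakI)
  from Lim_null_comparison[OF this lim]
  show ?thesis unfolding has_sum_def by (rule LIM_zero_cancel)
qed

text \<open>The density theorem: below the critical density no element of a Gabor frame lies outside the
  closed span of the others, which is here expressed by the absence of a biorthogonal vector.  If \<open>c = \<langle>h, g\<rangle> \<noteq> 0\<close>, the
  expansion of the indicator \<open>f\<close> of the cube of side \<open>a\<close> says that
  \<open>\<Sum>\<^sub>\<lambda> \<langle>f, \<pi>(\<lambda>)g\<rangle> \<langle>\<pi>(\<lambda>)h, f\<rangle> = c a\<^sup>n\<close>.  The same sum can be computed directly.  As \<open>a \<le> 1/b\<close>, Parseval's
  identity on the cube of side \<open>1/b\<close> evaluates the sum over the frequencies, and the integrals of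
  \<open>h(t - x) cnj (g(t - x))\<close> over the cube of side \<open>a\<close> that remain add up to the integral over the whole
  space.  The result is \<open>c / b\<^sup>n\<close>, whence \<open>(a b)\<^sup>n = 1\<close>.\<close>

theorem frame_not_biorthogonal:
  fixes g h :: "real ^ 'n \<Rightarrow> complex"
  assumes a: "a > 0" and b: "b > 0" and ab: "a * b < 1"
    and g: "square_integrable g" and frame: "gabor_frame g (rect_lattice a b)"
    and h: "square_integrable h"
    and orth: "\<And>z. z \<in> rect_lattice a b \<Longrightarrow> z \<noteq> 0 \<Longrightarrow> l2_inner h (tf_shift z g) = 0"
  shows "l2_inner h g = 0"
proof (rule ccontr)
  define c where "c = l2_inner h g"
  assume "l2_inner h g \<noteq> 0"
  then have c: "c \<noteq> 0" by (simp add: c_def)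
  let ?\<Lambda> = "rect_lattice a b :: ((real ^ 'n) \<times> (real ^ 'n)) set"
  let ?X = "(\<lambda>x. a *\<^sub>R x) ` int_lattice :: (real ^ 'n) set"
  let ?\<Gamma> = "(\<lambda>x. b *\<^sub>R x) ` int_lattice :: (real ^ 'n) set"
  let ?P = "half_open_cube a :: (real ^ 'n) set"
  let ?Q = "cbox 0 (vec (1/b)) :: (real ^ 'n) set"
  define V :: complex where "V = of_real ((1/b) ^ CARD('n))"
  have biorth: "l2_inner (tf_shift z h) (tf_shift w g) = (if z = w then c else 0)"
    if "z \<in> ?\<Lambda>" "w \<in> ?\<Lambda>" for z w
  proof (cases "z = w")
    case True
    then show ?thesis by (simp add: l2_inner_tf_shift h g c_def)
  next
    case False
    have "w - z \<in> ?\<Lambda>" using rect_lattice_add[OF that(2) rect_lattice_minus[OF that(1)]] by simp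
    then have "l2_inner h (tf_shift (w - z) g) = 0" using orth False by simp
    moreover have "cnj (character (- snd (w - z)) (fst z)) \<noteq> 0"
      using norm_character[of "- snd (w - z)" "fst z"] by (metis complex_cnj_zero_iff norm_zero zero_neq_one)
    ultimately show ?thesis
      using l2_inner_tf_shift_tf_shift[OF h g, of "w - z" z] False by simp
  qed
  have PQ: "?P \<subseteq> ?Q"
    using a b ab by (intro half_open_cube_subset) (simp add: pos_le_divide_eq)
  have P_sets: "?P \<in> sets lebesgue"
    by (intro sets_completionI_sets) (simp add: half_open_cube_borel)
  then have P_meas: "(indicator ?P :: _ \<Rightarrow> complex) \<in> borel_measurable lebesgue"
    by (intro borel_measurable_indicator)
  define f :: "real ^ 'n \<Rightarrow> complex" where "f = indicator ?P"
  have f_P: "square_integrable (\<lambda>t. f t * u t)" if "square_integrable u" for u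
    unfolding f_def by (intro square_integrable_bounded_mult that P_meas) (simp add: indicator_def)
  have f: "square_integrable f"
  proof -
    have "square_integrable (\<lambda>t. indicator ?Q t * f t)"
      unfolding f_def by (rule square_integrable_bounded_indicator(1)[OF P_meas, of _ 1]) (auto simp: indicator_def)
    moreover have "(\<lambda>t. indicator ?Q t * f t) = f"
      using PQ by (intro ext) (auto simp: f_def indicator_def)
    ultimately show ?thesis by simp
  qed
  have ff: "l2_inner f f = of_real (a ^ CARD('n))"
  proof -
    have "l2_inner f f = (LINT t|lebesgue. indicator ?P t)"
      unfolding l2_inner_def f_def by (intro Bochner_Integration.integral_cong refl) (simp add: indicator_def)
    then show ?thesis by (simp only: integral_indicator_half_open_cube[OF a])
  qed
  have sum: "((\<lambda>z. l2_inner f (tf_shift z g) * l2_inner (tf_shift z h) f) has_sum c * l2_inner f f) (?X \<times> ?\<Gamma>)"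
    using biorthogonal_expansion[OF g frame tf_shift_square_integrable[OF h] c biorth f f]
    by (simp only: rect_lattice_def)
  define \<phi> where "\<phi> t = V * (h t * cnj (g t))" for t
  have \<phi>: "integrable lebesgue \<phi>"
    unfolding \<phi>_def[abs_def] by (intro integrable_mult_right square_integrable_integrable_mult_cnj h g)
  have inner_sum: "((\<lambda>\<nu>. l2_inner f (tf_shift (x, \<nu>) g) * l2_inner (tf_shift (x, \<nu>) h) f) has_sum
      (LINT t|lebesgue. indicator ?P t * \<phi> (t - x))) ?\<Gamma>" for x
  proof -
    let ?G = "\<lambda>t. f t * cnj (g (t - x))" and ?H = "\<lambda>t. f t * cnj (h (t - x))"
    have G: "square_integrable ?G"
      by (intro f_P square_integrable_cnj square_integrable_translate g)
    have H: "square_integrable ?H"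
      by (intro f_P square_integrable_cnj square_integrable_translate h)
    have 1: "l2_inner f (tf_shift (x, \<nu>) g) = l2_inner ?G (cube_char b \<nu>)" for \<nu>
      unfolding l2_inner_def
    proof (intro Bochner_Integration.integral_cong refl)
      fix t
      show "f t * cnj (tf_shift (x, \<nu>) g t) = ?G t * cnj (cube_char b \<nu> t)"
        using PQ by (cases "t \<in> ?P") (auto simp: f_def tf_shift_eq cube_char_def)
    qed
    have 2: "l2_inner (tf_shift (x, \<nu>) h) f = l2_inner (cube_char b \<nu>) ?H" for \<nu>
      unfolding l2_inner_def
    proof (intro Bochner_Integration.integral_cong refl)
      fix t
      show "tf_shift (x, \<nu>) h t * cnj (f t) = cube_char b \<nu> t * cnj (?H t)"
        using PQ by (cases "t \<in> ?P") (auto simp: f_def tf_shift_eq cube_char_def)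
    qed
    have 3: "V * l2_inner ?G ?H = (LINT t|lebesgue. indicator ?P t * \<phi> (t - x))"
    proof -
      have "(LINT t|lebesgue. indicator ?P t * \<phi> (t - x)) = (LINT t|lebesgue. V * (?G t * cnj (?H t)))"
        by (intro Bochner_Integration.integral_cong refl) (simp add: f_def \<phi>_def indicator_def)
      then show ?thesis by (simp add: l2_inner_def)
    qed
    have "?G t = 0" if "t \<notin> ?Q" for t using that PQ by (auto simp: f_def indicator_def)
    then have "((\<lambda>\<nu>. l2_inner ?G (cube_char b \<nu>) * l2_inner (cube_char b \<nu>) ?H) has_sum V * l2_inner ?G ?H) ?\<Gamma>"
      unfolding V_def by (intro Parseval_cube b G H)
    then show ?thesis by (simp only: 1 2 3)
  qed
  have "((\<lambda>x. LINT t|lebesgue. indicator ?P t * \<phi> (t - x)) has_sum c * l2_inner f f) ?X"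
    by (rule has_sum_SigmaD[OF sum inner_sum])
  then have "c * l2_inner f f = (LINT t|lebesgue. \<phi> t)"
    by (rule tiling_integral[OF a \<phi>])
  also have "\<dots> = V * c" by (simp add: \<phi>_def[abs_def] c_def l2_inner_def)
  finally have "of_real (a ^ CARD('n)) = V" using c by (simp add: ff)
  then have "a ^ CARD('n) = (1/b) ^ CARD('n)" by (simp only: V_def of_real_eq_iff)
  then have "(a * b) ^ CARD('n) = 1" using b by (simp add: power_mult_distrib power_divide)
  moreover have "(a * b) ^ CARD('n) < 1" using a b ab by (intro power_less_one_iff[THEN iffD2]) auto
  ultimately show False by simp
qed

section \<open>Operators that vanish on a frame\<close>

text \<open>One step of the frame algorithm.  For a partial frame sum \<open>S = \<Sum>\<^bsub>z\<in>F\<^esub> \<langle>f, g\<^sub>z\<rangle> g\<^sub>z\<close> with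
  \<open>\<sigma> = \<Sum>\<^bsub>z\<in>F\<^esub> \<bar>\<langle>f, g\<^sub>z\<rangle>\<bar>\<^sup>2\<close>, duality and the upper bound give \<open>\<parallel>S\<parallel>\<^sup>2 \<le> B \<sigma>\<close>, hence
  \<open>\<parallel>f - S / B\<parallel>\<^sup>2 \<le> \<parallel>f\<parallel>\<^sup>2 - \<sigma> / B\<close>.  A finite \<open>F\<close> captures at least half of the lower bound \<open>A \<parallel>f\<parallel>\<^sup>2\<close>.  Working
  with finite sums throughout avoids both the inverse of the frame operator and completeness of \<open>L\<^sup>2\<close>.\<close>

lemma frame_contraction:
  assumes g: "square_integrable g" and frame: "gabor_frame g \<Lambda>"
  obtains q where "0 \<le> q" "q < 1"
    "\<And>f. square_integrable f \<Longrightarrow> \<exists>F c. finite F \<and> F \<subseteq> \<Lambda> \<and>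
       l2_norm (\<lambda>t. f t - (\<Sum>z\<in>F. c z * tf_shift z g t)) \<le> q * l2_norm f"
proof -
  obtain A B where A: "A > 0" and B: "B > 0"
    and summable: "\<And>f. square_integrable f \<Longrightarrow> (\<lambda>z. (cmod (l2_inner f (tf_shift z g)))\<^sup>2) summable_on \<Lambda>"
    and lower: "\<And>f. square_integrable f \<Longrightarrow>
      A * (l2_norm f)\<^sup>2 \<le> (\<Sum>\<^sub>\<infinity>z\<in>\<Lambda>. (cmod (l2_inner f (tf_shift z g)))\<^sup>2)"
    and upper: "\<And>f. square_integrable f \<Longrightarrow>
      (\<Sum>\<^sub>\<infinity>z\<in>\<Lambda>. (cmod (l2_inner f (tf_shift z g)))\<^sup>2) \<le> B * (l2_norm f)\<^sup>2"
    using frame unfolding gabor_frame_def by blast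
  note shift = tf_shift_square_integrable[OF g]
  define r where "r = max 0 (1 - A / (2 * B))"
  have r: "0 \<le> r" "r < 1" using A B by (auto simp: r_def)
  have "\<exists>F c. finite F \<and> F \<subseteq> \<Lambda> \<and>
       l2_norm (\<lambda>t. f t - (\<Sum>z\<in>F. c z * tf_shift z g t)) \<le> sqrt r * l2_norm f"
    if f: "square_integrable f" for f
  proof (cases "l2_norm f = 0")
    case True
    then show ?thesis by (intro exI[of _ "{}"]) simp
  next
    case False
    define N where "N = (l2_norm f)\<^sup>2"
    have N: "N > 0" using False by (simp add: N_def)
    define s where "s z = (cmod (l2_inner f (tf_shift z g)))\<^sup>2" for z
    have "A * N / 2 < A * N" using A N by simp
    also have "A * N \<le> infsum s \<Lambda>" using lower[OF f] by (simp add: N_def s_def[abs_def])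
    finally have "\<forall>\<^sub>F F in finite_subsets_at_top \<Lambda>. A * N / 2 < sum s F"
      using infsum_tendsto[OF summable[OF f]]
      by (intro order_tendstoD(1)) (auto simp: s_def[abs_def])
    then obtain F where F: "finite F" "F \<subseteq> \<Lambda>" "A * N / 2 < sum s F"
      unfolding eventually_finite_subsets_at_top by blast
    define \<sigma> where "\<sigma> = sum s F"
    define S where "S t = (\<Sum>z\<in>F. l2_inner f (tf_shift z g) * tf_shift z g t)" for t
    have S: "square_integrable S"
      unfolding S_def[abs_def] by (intro square_integrable_sum square_integrable_cmult shift)
    have S_inner: "l2_inner S u = (\<Sum>z\<in>F. l2_inner f (tf_shift z g) * l2_inner (tf_shift z g) u)"
      if "square_integrable u" for u
    proof -
      have "l2_inner S u = (\<Sum>z\<in>F. l2_inner (\<lambda>t. l2_inner f (tf_shift z g) * tf_shift z g t) u)"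
        unfolding S_def[abs_def] by (intro l2_inner_sum_left square_integrable_cmult shift that)
      then show ?thesis by (simp only: l2_inner_cmult_left)
    qed
    have Sf: "l2_inner f S = of_real \<sigma>"
    proof -
      have "l2_inner f (tf_shift z g) * l2_inner (tf_shift z g) f = of_real (s z)" for z
        unfolding l2_inner_commute[of "tf_shift z g" f] s_def by (simp only: complex_norm_square)
      then have "l2_inner S f = of_real \<sigma>" by (simp add: S_inner[OF f] \<sigma>_def)
      then show ?thesis by (simp add: l2_inner_commute[of f S])
    qed
    have S_norm: "(l2_norm S)\<^sup>2 \<le> B * \<sigma>"
    proof -
      define X where "X = (l2_norm S)\<^sup>2"
      have "X = cmod (l2_inner S S)" by (simp add: X_def l2_inner_self norm_power)
      also have "\<dots> \<le> (\<Sum>z\<in>F. cmod (l2_inner f (tf_shift z g)) * cmod (l2_inner S (tf_shift z g)))"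
        unfolding S_inner[OF S] by (rule sum_norm_le) (simp add: norm_mult l2_inner_commute[of _ S])
      finally have "X\<^sup>2 \<le> (\<Sum>z\<in>F. cmod (l2_inner f (tf_shift z g)) * cmod (l2_inner S (tf_shift z g)))\<^sup>2"
        by (intro power_mono) (auto simp: X_def)
      also have "\<dots> \<le> \<sigma> * (\<Sum>z\<in>F. (cmod (l2_inner S (tf_shift z g)))\<^sup>2)"
        unfolding \<sigma>_def s_def by (rule Cauchy_Schwarz_ineq_sum)
      also have "\<dots> \<le> \<sigma> * (\<Sum>\<^sub>\<infinity>z\<in>\<Lambda>. (cmod (l2_inner S (tf_shift z g)))\<^sup>2)"
        by (intro mult_left_mono finite_sum_le_infsum summable S F)
          (auto simp: \<sigma>_def s_def intro: sum_nonneg)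
      also have "\<dots> \<le> \<sigma> * (B * X)"
        unfolding X_def by (intro mult_left_mono upper S) (auto simp: \<sigma>_def s_def intro: sum_nonneg)
      finally have "X * X \<le> (B * \<sigma>) * X" by (simp add: power2_eq_square mult_ac)
      moreover have "0 \<le> X" "0 \<le> B * \<sigma>"
        using B by (auto simp: X_def \<sigma>_def s_def intro!: mult_nonneg_nonneg sum_nonneg)
      ultimately have "X \<le> B * \<sigma>" by (cases "X = 0") (simp_all add: mult_le_cancel_right)
      then show ?thesis by (simp add: X_def)
    qed
    define w where "w t = of_real (1 / B) * S t" for t
    have w: "square_integrable w" unfolding w_def[abs_def] by (intro square_integrable_cmult S)
    have "Re (l2_inner f w) = \<sigma> / B"
    proof -
      have "l2_inner w f = of_real (1 / B) * cnj (l2_inner f S)"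
        unfolding w_def[abs_def] l2_inner_cmult_left l2_inner_commute[of S f] ..
      then show ?thesis by (simp add: l2_inner_commute[of f w] Sf)
    qed
    moreover have "(l2_norm w)\<^sup>2 = (l2_norm S)\<^sup>2 / B\<^sup>2"
      unfolding w_def[abs_def] l2_norm_cmult by (simp add: power_mult_distrib norm_divide power_divide)
    ultimately have "(l2_norm (\<lambda>t. f t - w t))\<^sup>2 = N - 2 * (\<sigma> / B) + (l2_norm S)\<^sup>2 / B\<^sup>2"
      by (simp only: l2_norm_diff_square[OF f w] N_def)
    also have "\<dots> \<le> N - 2 * (\<sigma> / B) + (B * \<sigma>) / B\<^sup>2"
      using S_norm by (intro add_left_mono divide_right_mono) auto
    also have "\<dots> = N - \<sigma> / B" using B by (simp add: power2_eq_square)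
    also have "\<dots> \<le> N - (A * N / 2) / B"
      using F(3) B by (intro diff_left_mono divide_right_mono) (auto simp: \<sigma>_def)
    also have "\<dots> = (1 - A / (2 * B)) * N" by (simp add: field_simps)
    also have "\<dots> \<le> r * N" using N by (intro mult_right_mono) (auto simp: r_def)
    also have "\<dots> = (sqrt r * l2_norm f)\<^sup>2" using r by (simp add: N_def power_mult_distrib)
    finally have "l2_norm (\<lambda>t. f t - w t) \<le> sqrt r * l2_norm f"
      by (rule power2_le_imp_le) (simp add: r)
    moreover have "w = (\<lambda>t. \<Sum>z\<in>F. (of_real (1 / B) * l2_inner f (tf_shift z g)) * tf_shift z g t)"
      by (rule ext) (simp add: w_def S_def sum_distrib_left mult.assoc del: of_real_divide)
    ultimately show ?thesis
      using F(1,2) by (intro exI[of _ F] exI[of _ "\<lambda>z. of_real (1 / B) * l2_inner f (tf_shift z g)"]) simp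
  qed
  moreover have "0 \<le> sqrt r" "sqrt r < 1" using r by auto
  ultimately show ?thesis using that[of "sqrt r"] by simp
qed

lemma bounded_l2_operator_lincomb_null:
  assumes T: "bounded_l2_operator T" and f: "square_integrable f" and h: "square_integrable h"
    and f0: "l2_norm (T f) = 0" and h0: "l2_norm (T h) = 0"
  shows "l2_norm (T (\<lambda>t. \<alpha> * f t + \<beta> * h t)) = 0"
proof -
  have si: "square_integrable (T u)" if "square_integrable u" for u
    using T that by (simp add: bounded_l2_operator_def)
  have "AE x in lebesgue. T (\<lambda>t. \<alpha> * f t + \<beta> * h t) x = \<alpha> * T f x + \<beta> * T h x"
    using T f h by (simp add: bounded_l2_operator_def)
  moreover have "AE x in lebesgue. T f x = 0" "AE x in lebesgue. T h x = 0"
    using f0 h0 si f h by (simp_all add: l2_norm_eq_0_iff)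
  ultimately have "AE x in lebesgue. T (\<lambda>t. \<alpha> * f t + \<beta> * h t) x = 0"
    by eventually_elim simp
  then show ?thesis
    by (simp add: l2_norm_eq_0_iff si square_integrable_lincomb f h)
qed

text \<open>Subtracting a finite combination of frame elements does not change \<open>T f\<close> but shrinks \<open>f\<close> by the factor
  \<open>q\<close>.  Each repetition therefore improves the bound \<open>\<parallel>T f\<parallel> \<le> C \<parallel>f\<parallel>\<close> by that factor.\<close>

lemma bounded_l2_operator_zero_on_frame:
  assumes T: "bounded_l2_operator T"
    and g: "square_integrable g" and frame: "gabor_frame g \<Lambda>"
    and null: "\<And>z. z \<in> \<Lambda> \<Longrightarrow> l2_norm (T (tf_shift z g)) = 0"
    and f: "square_integrable f"
  shows "AE x in lebesgue. T f x = 0"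
proof -
  note shift = tf_shift_square_integrable[OF g]
  have si: "square_integrable (T u)" if "square_integrable u" for u
    using T that by (simp add: bounded_l2_operator_def)
  have lin: "AE x in lebesgue. T (\<lambda>t. \<alpha> * u t + \<beta> * v t) x = \<alpha> * T u x + \<beta> * T v x"
    if "square_integrable u" "square_integrable v" for u v \<alpha> \<beta>
    using T that by (simp add: bounded_l2_operator_def)
  have comb: "l2_norm (T (\<lambda>t. \<Sum>z\<in>F. c z * tf_shift z g t)) = 0" if "finite F" "F \<subseteq> \<Lambda>" for F c
    using that
  proof (induction F rule: finite_induct)
    case empty
    have "AE x in lebesgue. T (\<lambda>t. 0) x = 0"
      using lin[OF square_integrable_zero square_integrable_zero, of 0 0] by simp
    then show ?case by (simp add: l2_norm_eq_0_iff si square_integrable_zero)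
  next
    case (insert z F)
    have "l2_norm (T (\<lambda>t. c z * tf_shift z g t + 1 * (\<Sum>z\<in>F. c z * tf_shift z g t))) = 0"
      using insert by (intro bounded_l2_operator_lincomb_null[OF T] null shift
          square_integrable_sum square_integrable_cmult) auto
    then show ?case using insert.hyps by simp
  qed
  obtain q where q: "0 \<le> q" "q < 1"
    and approx: "\<And>f. square_integrable f \<Longrightarrow> \<exists>F c. finite F \<and> F \<subseteq> \<Lambda> \<and>
       l2_norm (\<lambda>t. f t - (\<Sum>z\<in>F. c z * tf_shift z g t)) \<le> q * l2_norm f"
    by (rule frame_contraction[OF g frame]) blast
  obtain C where C: "\<And>f. square_integrable f \<Longrightarrow> l2_norm (T f) \<le> C * l2_norm f"
    using T unfolding bounded_l2_operator_def by blast
  have bound: "l2_norm (T f) \<le> \<bar>C\<bar> * q ^ n * l2_norm f" if "square_integrable f" for f n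
    using that
  proof (induction n arbitrary: f)
    case 0
    have "C * l2_norm f \<le> \<bar>C\<bar> * l2_norm f" by (intro mult_right_mono) auto
    then show ?case using C[OF 0] by simp
  next
    case (Suc n)
    obtain F c where F: "finite F" "F \<subseteq> \<Lambda>"
      "l2_norm (\<lambda>t. f t - (\<Sum>z\<in>F. c z * tf_shift z g t)) \<le> q * l2_norm f"
      using approx[OF Suc.prems] by blast
    let ?w = "\<lambda>t. \<Sum>z\<in>F. c z * tf_shift z g t"
    let ?d = "\<lambda>t. f t - ?w t"
    have w: "square_integrable ?w" by (intro square_integrable_sum square_integrable_cmult shift)
    have d: "square_integrable ?d" by (intro square_integrable_diff Suc.prems w)
    have "AE x in lebesgue. T ?w x = 0"
      using comb[OF F(1,2), of c] l2_norm_eq_0_iff[OF si[OF w]] by blast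
    moreover have "AE x in lebesgue. T ?d x = T f x - T ?w x"
      using lin[OF Suc.prems w, of 1 "-1"] by simp
    ultimately have "AE x in lebesgue. T f x = T ?d x" by eventually_elim simp
    then have "l2_norm (T f) = l2_norm (T ?d)"
      by (rule l2_norm_cong_AE) (intro si Suc.prems d)+
    also have "\<dots> \<le> \<bar>C\<bar> * q ^ n * l2_norm ?d" by (rule Suc.IH[OF d])
    also have "\<dots> \<le> \<bar>C\<bar> * q ^ n * (q * l2_norm f)"
      using F(3) q by (intro mult_left_mono) auto
    finally show ?case by (simp add: mult_ac)
  qed
  have "(\<lambda>n. \<bar>C\<bar> * q ^ n * l2_norm f) \<longlonglongrightarrow> \<bar>C\<bar> * 0 * l2_norm f"
    by (intro tendsto_intros LIMSEQ_power_zero) (use q in auto)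
  then have "l2_norm (T f) \<le> \<bar>C\<bar> * 0 * l2_norm f"
    by (rule LIMSEQ_le_const) (use bound[OF f] in blast)
  then have "l2_norm (T f) = 0" using l2_norm_nonneg[of "T f"] by simp
  then show ?thesis by (simp add: l2_norm_eq_0_iff si f)
qed

section \<open>Diagonal Gabor matrices\<close>

theorem theorem4p2:
  fixes \<sigma> :: "((real ^ 'n) \<times> (real ^ 'n) \<Rightarrow> complex) \<Rightarrow> complex"
    and T :: "(real ^ 'n \<Rightarrow> complex) \<Rightarrow> (real ^ 'n \<Rightarrow> complex)"
    and g :: "real ^ 'n \<Rightarrow> complex"
    and a b :: real
    and d :: "(real ^ 'n) \<times> (real ^ 'n) \<Rightarrow> complex"
  assumes "tempered_distribution \<sigma>"
    and "kn_bounded_extension \<sigma> T"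
    and "a > 0" and "b > 0" and "a * b < 1"
    and "square_integrable g"
    and "gabor_frame g (rect_lattice a b)"
    and "\<And>\<nu> \<mu>. \<nu> \<in> rect_lattice a b \<Longrightarrow> \<mu> \<in> rect_lattice a b \<Longrightarrow>
           l2_inner (T (tf_shift \<mu> g)) (tf_shift \<nu> g) = (if \<nu> = \<mu> then d \<mu> else 0)"
  shows "\<forall>f. square_integrable f \<longrightarrow> (AE x in lebesgue. T f x = 0)"
proof -
  let ?\<Lambda> = "rect_lattice a b :: ((real ^ 'n) \<times> (real ^ 'n)) set"
  note g = assms(6) and frame = assms(7)
  have T: "bounded_l2_operator T" using assms(2) by (simp add: kn_bounded_extension_def)
  obtain A where A: "A > 0"
    and lower: "\<And>f. square_integrable f \<Longrightarrow>
      A * (l2_norm f)\<^sup>2 \<le> (\<Sum>\<^sub>\<infinity>z\<in>?\<Lambda>. (cmod (l2_inner f (tf_shift z g)))\<^sup>2)"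
    using frame unfolding gabor_frame_def by blast
  have "l2_norm (T (tf_shift \<mu> g)) = 0" if \<mu>: "\<mu> \<in> ?\<Lambda>" for \<mu>
  proof -
    \<comment> \<open>Shifting \<open>?u\<close> back by \<open>\<mu>\<close> moves the exceptional index to the origin.\<close>
    let ?u = "T (tf_shift \<mu> g)" and ?h = "tf_shift (- \<mu>) (T (tf_shift \<mu> g))"
    have u: "square_integrable ?u"
      using T tf_shift_square_integrable[OF g] by (simp add: bounded_l2_operator_def)
    have unimodular: "cnj (character \<nu> t) \<noteq> 0" for \<nu> t :: "real ^ 'n"
      using norm_character[of \<nu> t] by (metis complex_cnj_zero_iff norm_zero zero_neq_one)
    have "l2_inner ?h (tf_shift z g) = 0" if z: "z \<in> ?\<Lambda>" "z \<noteq> 0" for z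
    proof -
      have "z + \<mu> \<noteq> \<mu>" using z(2) by simp
      then have "l2_inner ?u (tf_shift (z + \<mu>) g) = 0"
        by (subst assms(8)) (use rect_lattice_add[OF z(1) \<mu>] \<mu> in auto)
      then show ?thesis
        using l2_inner_tf_shift_tf_shift[OF u g, of "z + \<mu>" "- \<mu>"] unimodular by simp
    qed
    then have "l2_inner ?h g = 0"
      by (rule frame_not_biorthogonal[OF assms(3,4,5) g frame tf_shift_square_integrable[OF u]])
    then have "l2_inner ?u (tf_shift \<mu> g) = 0"
      using l2_inner_tf_shift_tf_shift[OF u g, of \<mu> "- \<mu>"] by simp
    then have "d \<mu> = 0" using assms(8)[OF \<mu> \<mu>] by simp
    then have "l2_inner ?u (tf_shift \<nu> g) = 0" if "\<nu> \<in> ?\<Lambda>" for \<nu>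
      using assms(8)[OF that \<mu>] by simp
    then have "(\<Sum>\<^sub>\<infinity>z\<in>?\<Lambda>. (cmod (l2_inner ?u (tf_shift z g)))\<^sup>2) = 0"
      by (intro infsum_0) simp
    then have "A * (l2_norm ?u)\<^sup>2 \<le> 0" using lower[OF u] by simp
    then show ?thesis using A by (simp add: mult_le_0_iff)
  qed
  then show ?thesis
    using bounded_l2_operator_zero_on_frame[OF T g frame] by blast
qed

end
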